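(* For any non-negative locally finite Borel measures $\varphi,\psi$ on $\mathbb R^d$, the site-optimal density $f_s$ for $(\varphi,\psi)$ is a stable constrained density. Moreover, $f_s$ depends measurably on $(\varphi,\psi)$ and is translation-covariant (so in the random setting it is flow-adapted).
   Context: Densities: a non-negative measurable $f$ on $\mathbb R^d\times\mathbb R^d$ is sub-balancing for $(\varphi,\psi)$ if $\int f(x,\xi)\psi(d\xi)\le1$ for all $x$ and $\int f(x,\xi)\varphi(dx)\le 1$ for all $\xi$; constrained if sub-balancing and $f\le1$ everywhere. Stability: given a constrained density $f$, a site $x_0$ is exhausted if $\int f(x_0,\xi)\psi(d\xi)=1$ and unexhausted otherwise; a center $\xi_0$ is sated if $\int f(x,\xi_0)\varphi(dx)=1$ and unsated otherwise. A site $x_0$ desires a center $\xi_0$ if $f(x_0,\xi_0)<1$ and either $x_0$ is unexhausted or there is $\xi_1$ with $|x_0-\xi_1|>|x_0-\xi_0|$ and $f(x_0,\xi_1)>0$. A center $\xi_0$ desires a site $x_0$ if $f(x_0,\xi_0)<1$ and either $\xi_0$ is unsated or there is $x_1$ with $|x_1-\xi_0|>|x_0-\xi_0|$ and $f(x_1,\xi_0)>0$. $f$ is stable if there is no pair $(x_0,\xi_0)$ such that $x_0$ desires $\xi_0$ and $\xi_0$ desires $x_0$. Site-optimal density: $\overline B(x,r)$ is the closed ball (empty if $r<0$). $R_0\equiv0$; at stage $n\ge1$: (i) $a_n(x_0)=\sup\{a:\int_{\overline B(x_0,a)}(1-R_{n-1}(x_0,\xi))\psi(d\xi)\le1\}$;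 $A_n(x_0,\xi)=1$ if $|x_0-\xi|<a_n(x_0)$, $=cR_{n-1}(x_0,\xi)+1-c$ if $|x_0-\xi|=a_n(x_0)$, $=0$ if $|x_0-\xi|>a_n(x_0)$, with $c\in[0,1]$ chosen so that $\int(A_n-R_{n-1})(x_0,\xi)\psi(d\xi)=1$ if $a_n(x_0)<\infty$, and $c=1$ if $a_n(x_0)=\infty$ or $\psi(\partial\overline B(x_0,a_n(x_0)))=0$. (ii) $r_n(\xi_0)=\sup\{r:\int_{\overline B(\xi_0,r)}A_n(x,\xi_0)\varphi(dx)\le1\}$; $R_n(x,\xi_0)=0$ if $|x-\xi_0|<r_n(\xi_0)$, $=c'A_n(x,\xi_0)$ if $|x-\xi_0|=r_n(\xi_0)$, $=A_n(x,\xi_0)$ if $|x-\xi_0|>r_n(\xi_0)$, with $c'\in[0,1]$ chosen so that $\int(A_n-R_n)(x,\xi_0)\varphi(dx)=1$ if $r_n(\xi_0)<\infty$, and $c'=0$ if $r_n(\xi_0)=\infty$ or $\varphi(\partial\overline B(\xi_0,r_n(\xi_0)))=0$. The sequences $A_n,R_n$ are non-decreasing in $n$; put $A=\lim A_n$, $R=\lim R_n$ and $f_s=A-R$. *)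

theory Defs
  imports "HOL-Analysis.Analysis"
begin

text \<open>Measures on R^d are modelled as measures on a Euclidean space 'a with
  Borel sets; a density is a function f :: 'a => 'a => real
  (first argument: site x, second argument: center xi).\<close>

definition locally_finite_borel :: "'a::euclidean_space measure \<Rightarrow> bool" where
  "locally_finite_borel M \<longleftrightarrow> sets M = sets borel \<and> (\<forall>K. compact K \<longrightarrow> emeasure M K < \<infinity>)"

definition density :: "('a::euclidean_space \<Rightarrow> 'a \<Rightarrow> real) \<Rightarrow> bool" where
  "density f \<longleftrightarrow> (\<forall>x \<xi>. 0 \<le> f x \<xi>) \<and> case_prod f \<in> borel_measurable (borel \<Otimes>\<^sub>M borel)"

definition sub_balancing :: "'a::euclidean_space measure \<Rightarrow> 'a measure \<Rightarrow> ('a \<Rightarrow> 'a \<Rightarrow> real) \<Rightarrow> bool" where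
  "sub_balancing \<phi> \<psi> f \<longleftrightarrow>
     (\<forall>x. (\<integral>\<^sup>+ \<xi>. ennreal (f x \<xi>) \<partial>\<psi>) \<le> 1) \<and> (\<forall>\<xi>. (\<integral>\<^sup>+ x. ennreal (f x \<xi>) \<partial>\<phi>) \<le> 1)"

definition constrained :: "'a::euclidean_space measure \<Rightarrow> 'a measure \<Rightarrow> ('a \<Rightarrow> 'a \<Rightarrow> real) \<Rightarrow> bool" where
  "constrained \<phi> \<psi> f \<longleftrightarrow> density f \<and> sub_balancing \<phi> \<psi> f \<and> (\<forall>x \<xi>. f x \<xi> \<le> 1)"

definition exhausted :: "'a::euclidean_space measure \<Rightarrow> ('a \<Rightarrow> 'a \<Rightarrow> real) \<Rightarrow> 'a \<Rightarrow> bool" where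
  "exhausted \<psi> f x0 \<longleftrightarrow> (\<integral>\<^sup>+ \<xi>. ennreal (f x0 \<xi>) \<partial>\<psi>) = 1"

definition sated :: "'a::euclidean_space measure \<Rightarrow> ('a \<Rightarrow> 'a \<Rightarrow> real) \<Rightarrow> 'a \<Rightarrow> bool" where
  "sated \<phi> f \<xi>0 \<longleftrightarrow> (\<integral>\<^sup>+ x. ennreal (f x \<xi>0) \<partial>\<phi>) = 1"

definition site_desires :: "'a::euclidean_space measure \<Rightarrow> ('a \<Rightarrow> 'a \<Rightarrow> real) \<Rightarrow> 'a \<Rightarrow> 'a \<Rightarrow> bool" where
  "site_desires \<psi> f x0 \<xi>0 \<longleftrightarrow> f x0 \<xi>0 < 1 \<and>
     (\<not> exhausted \<psi> f x0 \<or> (\<exists>\<xi>1. dist x0 \<xi>1 > dist x0 \<xi>0 \<and> f x0 \<xi>1 > 0))"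

definition center_desires :: "'a::euclidean_space measure \<Rightarrow> ('a \<Rightarrow> 'a \<Rightarrow> real) \<Rightarrow> 'a \<Rightarrow> 'a \<Rightarrow> bool" where
  "center_desires \<phi> f \<xi>0 x0 \<longleftrightarrow> f x0 \<xi>0 < 1 \<and>
     (\<not> sated \<phi> f \<xi>0 \<or> (\<exists>x1. dist x1 \<xi>0 > dist x0 \<xi>0 \<and> f x1 \<xi>0 > 0))"

definition stable :: "'a::euclidean_space measure \<Rightarrow> 'a measure \<Rightarrow> ('a \<Rightarrow> 'a \<Rightarrow> real) \<Rightarrow> bool" where
  "stable \<phi> \<psi> f \<longleftrightarrow> \<not> (\<exists>x0 \<xi>0. site_desires \<psi> f x0 \<xi>0 \<and> center_desires \<phi> f \<xi>0 x0)"

definition a_rad :: "'a::euclidean_space measure \<Rightarrow> ('a \<Rightarrow> 'a \<Rightarrow> real) \<Rightarrow> 'a \<Rightarrow> ereal" where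
  "a_rad \<psi> R x0 = Sup (ereal ` {a. (\<integral>\<^sup>+ \<xi>\<in>cball x0 a. ennreal (1 - R x0 \<xi>) \<partial>\<psi>) \<le> 1})"

definition A_upd :: "'a::euclidean_space measure \<Rightarrow> ('a \<Rightarrow> 'a \<Rightarrow> real) \<Rightarrow> 'a \<Rightarrow> 'a \<Rightarrow> real" where
  "A_upd \<psi> R x0 \<xi> =
    (let a = a_rad \<psi> R x0;
         g = (\<lambda>c::real. \<lambda>\<eta>. if ereal (dist x0 \<eta>) < a then 1
                     else if ereal (dist x0 \<eta>) = a then c * R x0 \<eta> + 1 - c else 0);
         c = (if a = \<infinity> \<or> emeasure \<psi> (sphere x0 (real_of_ereal a)) = 0 then 1
              else Sup {c \<in> {0..1}. (\<integral>\<^sup>+ \<eta>. ennreal (g c \<eta> - R x0 \<eta>) \<partial>\<psi>) = 1})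
     in g c \<xi>)"

definition r_rad :: "'a::euclidean_space measure \<Rightarrow> ('a \<Rightarrow> 'a \<Rightarrow> real) \<Rightarrow> 'a \<Rightarrow> ereal" where
  "r_rad \<phi> A \<xi>0 = Sup (ereal ` {r. (\<integral>\<^sup>+ x\<in>cball \<xi>0 r. ennreal (A x \<xi>0) \<partial>\<phi>) \<le> 1})"

definition R_upd :: "'a::euclidean_space measure \<Rightarrow> ('a \<Rightarrow> 'a \<Rightarrow> real) \<Rightarrow> 'a \<Rightarrow> 'a \<Rightarrow> real" where
  "R_upd \<phi> A x \<xi>0 =
    (let r = r_rad \<phi> A \<xi>0;
         h = (\<lambda>c::real. \<lambda>y. if ereal (dist y \<xi>0) < r then 0
                     else if ereal (dist y \<xi>0) = r then c * A y \<xi>0 else A y \<xi>0);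
         c = (if r = \<infinity> \<or> emeasure \<phi> (sphere \<xi>0 (real_of_ereal r)) = 0 then 0
              else Inf {c \<in> {0..1}. (\<integral>\<^sup>+ y. ennreal (A y \<xi>0 - h c y) \<partial>\<phi>) = 1})
     in h c x)"

primrec so_stages :: "'a::euclidean_space measure \<Rightarrow> 'a measure \<Rightarrow> nat \<Rightarrow>
    ('a \<Rightarrow> 'a \<Rightarrow> real) \<times> ('a \<Rightarrow> 'a \<Rightarrow> real)" where
  "so_stages \<phi> \<psi> 0 = ((\<lambda>_ _. 0), (\<lambda>_ _. 0))"
| "so_stages \<phi> \<psi> (Suc n) =
     (let A = A_upd \<psi> (snd (so_stages \<phi> \<psi> n)) in (A, R_upd \<phi> A))"

definition site_optimal :: "'a::euclidean_space measure \<Rightarrow> 'a measure \<Rightarrow> 'a \<Rightarrow> 'a \<Rightarrow> real" where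
  "site_optimal \<phi> \<psi> x \<xi> =
     lim (\<lambda>n. fst (so_stages \<phi> \<psi> n) x \<xi>) - lim (\<lambda>n. snd (so_stages \<phi> \<psi> n) x \<xi>)"

definition lf_measures :: "('a::euclidean_space measure) measure" where
  "lf_measures = (SUP B \<in> sets (borel :: 'a measure).
      vimage_algebra {M. locally_finite_borel M} (\<lambda>M. emeasure M B) borel)"

end

theory Submission
  imports Defs
begin

text \<open>Both half-steps of the algorithm are instances of one operation: from a \<open>[0, 1]\<close>-valued
  profile \<open>u\<close> take \<open>\<mu>\<close>-mass 1 (or everything, if less is available) as close to a point as possible,
  taking a constant share of \<open>u\<close> on the bounding sphere. Sites apply it to \<open>1 - R\<^sub>n\<close>, centers to
  \<open>A\<^sub>n\<close>. Larger profiles give smaller radii and, at equal radii, smaller shares, whence \<open>A\<^sub>n\<close> and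
  \<open>R\<^sub>n\<close> increase; Fatou's lemma then gives the sub-balancing inequalities.

  For stability, a site that is unexhausted or has positive density at a farther center
  has at some stage applied fully to every closer center, so \<open>A = 1\<close> there; a center that is unsated
  or has positive density at a farther site never rejects a closer site, so \<open>R = 0\<close> there. If both
  happen at a pair, then \<open>f\<^sub>s = A - R = 1\<close>, so neither desires the other.\<close>

subsection \<open>Integration against locally finite kernels\<close>

lemma space_lf_measures: "space lf_measures = {M. locally_finite_borel M}"
  by (auto simp: lf_measures_def space_Sup_eq_UN)

lemma measurable_emeasure_lf_measures:
  "B \<in> sets borel \<Longrightarrow> (\<lambda>M. emeasure M B) \<in> borel_measurable lf_measures"
  unfolding lf_measures_def
  by (rule measurable_SUP1[where i = B]) (auto intro: measurable_vimage_algebra1)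

lemma sets_locally_finite_borel: "locally_finite_borel M \<Longrightarrow> sets M = sets borel"
  by (simp add: locally_finite_borel_def)

lemma space_locally_finite_borel: "locally_finite_borel M \<Longrightarrow> space M = UNIV"
  using sets_eq_imp_space_eq[of M borel] by (simp add: locally_finite_borel_def)

text \<open>The complement step of the pi-lambda induction subtracts measures and so needs
  finiteness, which a locally finite kernel guarantees only on bounded sets. The induction is
  therefore run for sections cut to \<open>cball 0 (real n)\<close>, and continuity from below
  removes the cut.\<close>

lemma measurable_kernel_emeasure_Pair:
  fixes k :: "'w \<Rightarrow> 'a::euclidean_space measure"
  assumes k: "k \<in> measurable \<Omega> lf_measures" and Q: "Q \<in> sets (\<Omega> \<Otimes>\<^sub>M borel)"
  shows "(\<lambda>w. emeasure (k w) (Pair w -` Q)) \<in> borel_measurable \<Omega>"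
proof -
  have kB: "(\<lambda>w. emeasure (k w) B) \<in> borel_measurable \<Omega>" if "B \<in> sets borel" for B
    using measurable_compose[OF k measurable_emeasure_lf_measures[OF that]] .
  have lf: "locally_finite_borel (k w)" if "w \<in> space \<Omega>" for w
    using measurable_space[OF k that] by (simp add: space_lf_measures)
  have fin: "emeasure (k w) (B \<inter> cball 0 (real n)) < \<infinity>"
    if "w \<in> space \<Omega>" "B \<in> sets borel" for B w n
  proof -
    have "emeasure (k w) (B \<inter> cball 0 (real n)) \<le> emeasure (k w) (cball 0 (real n))"
      by (rule emeasure_mono) (auto simp: sets_locally_finite_borel[OF lf[OF that(1)]])
    also have "\<dots> < \<infinity>" using lf[OF that(1)] by (simp add: locally_finite_borel_def)
    finally show ?thesis .
  qed
  have cut: "(\<lambda>w. emeasure (k w) (Pair w -` Q \<inter> cball 0 (real n))) \<in> borel_measurable \<Omega>" for n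
    using Int_stable_pair_measure_generator pair_measure_closed Q
    unfolding sets_pair_measure
  proof (induction rule: sigma_sets_induct_disjoint)
    case (basic A)
    then obtain S T where A: "A = S \<times> T" "S \<in> sets \<Omega>" "T \<in> sets borel" by auto
    have "(\<lambda>w. emeasure (k w) (Pair w -` A \<inter> cball 0 (real n))) =
          (\<lambda>w. indicator S w * emeasure (k w) (T \<inter> cball 0 (real n)))"
      by (auto simp: A indicator_def fun_eq_iff)
    then show ?case using kB[of "T \<inter> cball 0 (real n)"] A by simp
  next
    case empty
    then show ?case by simp
  next
    case (compl A)
    have A: "A \<in> sets (\<Omega> \<Otimes>\<^sub>M borel)" using compl(1) by (simp add: sets_pair_measure)
    have "emeasure (k w) (Pair w -` (space \<Omega> \<times> space borel - A) \<inter> cball 0 (real n)) =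
          emeasure (k w) (cball 0 (real n)) - emeasure (k w) (Pair w -` A \<inter> cball 0 (real n))"
      if w: "w \<in> space \<Omega>" for w
    proof -
      have "Pair w -` (space \<Omega> \<times> space borel - A) \<inter> cball 0 (real n) =
            cball 0 (real n) - (Pair w -` A \<inter> cball 0 (real n))"
        using w by auto
      then show ?thesis
        using fin[OF w sets_Pair1[OF A], of w n] sets_Pair1[OF A, of w]
        by (simp add: emeasure_Diff sets_locally_finite_borel[OF lf[OF w]] less_top)
    qed
    then show ?case
      using kB[of "cball 0 (real n)"] compl(2) by (simp cong: measurable_cong)
  next
    case (union F)
    have F: "F i \<in> sets (\<Omega> \<Otimes>\<^sub>M borel)" for i
      using union(2) by (auto simp: sets_pair_measure)
    have "emeasure (k w) (Pair w -` (\<Union>i. F i) \<inter> cball 0 (real n)) =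
          (\<Sum>i. emeasure (k w) (Pair w -` F i \<inter> cball 0 (real n)))"
      if w: "w \<in> space \<Omega>" for w
    proof -
      have *: "disjoint_family (\<lambda>i. Pair w -` F i \<inter> cball 0 (real n))"
        using union(1) by (auto simp: disjoint_family_on_def)
      have "Pair w -` (\<Union>i. F i) \<inter> cball 0 (real n) = (\<Union>i. Pair w -` F i \<inter> cball 0 (real n))"
        by auto
      then show ?thesis
        using sets_Pair1[OF F, of w]
        by (subst suminf_emeasure[OF _ *]) (auto simp: sets_locally_finite_borel[OF lf[OF w]])
    qed
    then show ?case using union(3) by (simp cong: measurable_cong)
  qed
  have "emeasure (k w) (Pair w -` Q) = (SUP n. emeasure (k w) (Pair w -` Q \<inter> cball 0 (real n)))"
    if w: "w \<in> space \<Omega>" for w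
  proof -
    have "Pair w -` Q = (\<Union>n. Pair w -` Q \<inter> cball 0 (real n))"
      by (auto simp: real_arch_simple)
    then show ?thesis
      using sets_Pair1[OF Q, of w]
      by (subst SUP_emeasure_incseq)
        (auto simp: sets_locally_finite_borel[OF lf[OF w]] incseq_def real_arch_simple)
  qed
  moreover have "(\<lambda>w. SUP n. emeasure (k w) (Pair w -` Q \<inter> cball 0 (real n))) \<in> borel_measurable \<Omega>"
    using cut by measurable
  ultimately show ?thesis by (simp cong: measurable_cong)
qed

text \<open>Here the measure itself varies with the parameter; this is the source of measurability
  in \<open>(\<phi>, \<psi>)\<close>. Indicators are covered by the previous lemma, and linearity
  and monotone convergence do the rest.\<close>

lemma measurable_kernel_nn_integral:
  fixes k :: "'w \<Rightarrow> 'a::euclidean_space measure"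
  assumes k: "k \<in> measurable \<Omega> lf_measures"
    and f: "case_prod f \<in> borel_measurable (\<Omega> \<Otimes>\<^sub>M borel)"
  shows "(\<lambda>w. \<integral>\<^sup>+ y. f w y \<partial>k w) \<in> borel_measurable \<Omega>"
proof -
  have lf: "locally_finite_borel (k w)" if "w \<in> space \<Omega>" for w
    using measurable_space[OF k that] by (simp add: space_lf_measures)
  have sec: "(\<lambda>y. g (w, y)) \<in> borel_measurable (k w)"
    if "g \<in> borel_measurable (\<Omega> \<Otimes>\<^sub>M borel)" "w \<in> space \<Omega>" for w and g :: "'w \<times> 'a \<Rightarrow> ennreal"
    using measurable_Pair2[OF that]
      measurable_cong_sets[OF sets_locally_finite_borel[OF lf[OF that(2)]] refl] by blast
  have "(\<lambda>w. \<integral>\<^sup>+ y. g (w, y) \<partial>k w) \<in> borel_measurable \<Omega>"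
    if "g \<in> borel_measurable (\<Omega> \<Otimes>\<^sub>M borel)" for g
    using that
  proof induct
    case (cong u v)
    then have "(\<integral>\<^sup>+ y. u (w, y) \<partial>k w) = (\<integral>\<^sup>+ y. v (w, y) \<partial>k w)" if "w \<in> space \<Omega>" for w
      using that by (intro nn_integral_cong) (simp add: space_pair_measure)
    then show ?case using cong by (simp cong: measurable_cong)
  next
    case (set Q)
    have "(\<integral>\<^sup>+ y. indicator Q (w, y) \<partial>k w) = emeasure (k w) (Pair w -` Q)"
      if w: "w \<in> space \<Omega>" for w
    proof -
      have "(\<integral>\<^sup>+ y. indicator Q (w, y) \<partial>k w) = (\<integral>\<^sup>+ y. indicator (Pair w -` Q) y \<partial>k w)"
        by (simp add: indicator_def)
      then show ?thesis
        using sets_Pair1[OF set, of w]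
        by (simp add: sets_locally_finite_borel[OF lf[OF w]])
    qed
    then show ?case
      using measurable_kernel_emeasure_Pair[OF k set] by (simp cong: measurable_cong)
  next
    case (mult u c)
    then show ?case by (simp add: nn_integral_cmult sec cong: measurable_cong)
  next
    case (add u v)
    then show ?case by (simp add: nn_integral_add sec cong: measurable_cong)
  next
    case (seq F)
    have "(\<integral>\<^sup>+ y. (SUP i. F i) (w, y) \<partial>k w) = (SUP i. \<integral>\<^sup>+ y. F i (w, y) \<partial>k w)"
      if "w \<in> space \<Omega>" for w
      using seq that
      by (simp add: SUP_apply image_comp nn_integral_monotone_convergence_SUP incseq_def le_fun_def sec)
    then show ?case using seq by (simp cong: measurable_cong)
  qed
  from this[OF f] show ?thesis by simp
qed

subsection \<open>Taking mass 1 as close to a point as possible\<close>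

text \<open>Negative radii give empty balls, so the set is never empty. For a
  \<open>mass_profile\<close> the value \<open>\<infinity>\<close> occurs exactly when the whole
  space carries mass at most 1.\<close>

definition fill_radius :: "'a::euclidean_space measure \<Rightarrow> ('a \<Rightarrow> real) \<Rightarrow> 'a \<Rightarrow> ereal" where
  "fill_radius \<mu> u x = Sup (ereal ` {a. (\<integral>\<^sup>+ y\<in>cball x a. ennreal (u y) \<partial>\<mu>) \<le> 1})"

definition inner_mass :: "'a::euclidean_space measure \<Rightarrow> ('a \<Rightarrow> real) \<Rightarrow> 'a \<Rightarrow> ennreal" where
  "inner_mass \<mu> u x = (\<integral>\<^sup>+ y\<in>{y. ereal (dist x y) < fill_radius \<mu> u x}. ennreal (u y) \<partial>\<mu>)"

definition rim_mass :: "'a::euclidean_space measure \<Rightarrow> ('a \<Rightarrow> real) \<Rightarrow> 'a \<Rightarrow> ennreal" where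
  "rim_mass \<mu> u x = (\<integral>\<^sup>+ y\<in>{y. ereal (dist x y) = fill_radius \<mu> u x}. ennreal (u y) \<partial>\<mu>)"

text \<open>On a null rim the conventions differ: \<open>A_upd\<close> takes the largest \<open>c\<close> (share
  \<open>1 - c = 0\<close>), \<open>R_upd\<close> the smallest (share 1). The parameter \<open>e\<close> is this share.\<close>
definition rim_share :: "real \<Rightarrow> 'a::euclidean_space measure \<Rightarrow> ('a \<Rightarrow> real) \<Rightarrow> 'a \<Rightarrow> real" where
  "rim_share e \<mu> u x =
    (if rim_mass \<mu> u x = 0 then e else (1 - enn2real (inner_mass \<mu> u x)) / enn2real (rim_mass \<mu> u x))"

definition fill :: "real \<Rightarrow> 'a::euclidean_space measure \<Rightarrow> ('a \<Rightarrow> real) \<Rightarrow> 'a \<Rightarrow> 'a \<Rightarrow> real" where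
  "fill e \<mu> u x y =
    (if ereal (dist x y) < fill_radius \<mu> u x then u y
     else if ereal (dist x y) = fill_radius \<mu> u x then rim_share e \<mu> u x * u y else 0)"

lemma ereal_dense_rat: "(x::ereal) < y \<Longrightarrow> \<exists>q::rat. x < ereal (of_rat q) \<and> ereal (of_rat q) < y"
  using ereal_dense3[of x y] by auto

text \<open>The defining supremum is uncountable and does not yield measurability directly. Ball
  masses grow with the radius, so rational radii suffice; a failing rational contributes
  \<open>- \<infinity>\<close>, which leaves the supremum unchanged.\<close>

lemma fill_radius_eq_rat:
  "fill_radius \<mu> u x =
     (SUP q::rat. if (\<integral>\<^sup>+ y\<in>cball x (of_rat q). ennreal (u y) \<partial>\<mu>) \<le> 1 then ereal (of_rat q) else - \<infinity>)"
proof (rule antisym)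
  define g :: "rat \<Rightarrow> ereal" where
    "g = (\<lambda>q. if (\<integral>\<^sup>+ y\<in>cball x (of_rat q). ennreal (u y) \<partial>\<mu>) \<le> 1 then ereal (of_rat q) else - \<infinity>)"
  have "ereal a \<le> (SUP q. g q)" if a: "(\<integral>\<^sup>+ y\<in>cball x a. ennreal (u y) \<partial>\<mu>) \<le> 1" for a
  proof (rule dense_le)
    fix z assume "z < ereal a"
    then obtain q :: rat where q: "z < ereal (of_rat q)" "ereal (of_rat q) < ereal a"
      using ereal_dense_rat by blast
    have "(\<integral>\<^sup>+ y\<in>cball x (of_rat q). ennreal (u y) \<partial>\<mu>) \<le> (\<integral>\<^sup>+ y\<in>cball x a. ennreal (u y) \<partial>\<mu>)"
      using q(2) by (intro nn_integral_mono) (auto simp: indicator_def)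
    then have "(\<integral>\<^sup>+ y\<in>cball x (of_rat q). ennreal (u y) \<partial>\<mu>) \<le> 1"
      using a by (rule order_trans)
    then have "g q = ereal (of_rat q)" by (simp only: g_def if_True)
    with q(1) show "z \<le> (SUP q. g q)"
      using SUP_upper[of q UNIV g] by (metis UNIV_I less_imp_le order_trans)
  qed
  then show "fill_radius \<mu> u x \<le> (SUP q. g q)"
    unfolding fill_radius_def by (intro SUP_least) blast
  have "g q \<le> fill_radius \<mu> u x" for q
  proof (cases "(\<integral>\<^sup>+ y\<in>cball x (of_rat q). ennreal (u y) \<partial>\<mu>) \<le> 1")
    case True
    then show ?thesis unfolding g_def fill_radius_def by (intro SUP_upper2[where i = "of_rat q"]) auto
  qed (simp add: g_def)
  then show "(SUP q. g q) \<le> fill_radius \<mu> u x" by (rule SUP_least)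
qed

text \<open>The radius comes first, since it cuts out the regions of \<open>inner_mass\<close> and
  \<open>rim_mass\<close>. After that both masses are kernel integrals of jointly measurable
  functions.\<close>

lemma
  fixes k :: "'w \<Rightarrow> 'a::euclidean_space measure"
  assumes k: "k \<in> measurable \<Omega> lf_measures" and x[measurable]: "x \<in> borel_measurable \<Omega>"
    and u[measurable]: "case_prod u \<in> borel_measurable (\<Omega> \<Otimes>\<^sub>M borel)"
  shows measurable_fill_radius: "(\<lambda>w. fill_radius (k w) (u w) (x w)) \<in> borel_measurable \<Omega>"
    and measurable_fill:
      "(\<lambda>(w, y). fill e (k w) (u w) (x w) y) \<in> borel_measurable (\<Omega> \<Otimes>\<^sub>M borel)"
proof -
  have meas [measurable]: "(\<lambda>w. \<integral>\<^sup>+ y\<in>cball (x w) a. ennreal (u w y) \<partial>k w) \<in> borel_measurable \<Omega>" for a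
    by (rule measurable_kernel_nn_integral[OF k]) (unfold indicator_def mem_cball, measurable)
  show rad [measurable]: "(\<lambda>w. fill_radius (k w) (u w) (x w)) \<in> borel_measurable \<Omega>"
    unfolding fill_radius_eq_rat by measurable
  have [measurable]: "(\<lambda>w. inner_mass (k w) (u w) (x w)) \<in> borel_measurable \<Omega>"
    unfolding inner_mass_def
    by (rule measurable_kernel_nn_integral[OF k]) (unfold indicator_def mem_Collect_eq, measurable)
  have [measurable]: "(\<lambda>w. rim_mass (k w) (u w) (x w)) \<in> borel_measurable \<Omega>"
    unfolding rim_mass_def
    by (rule measurable_kernel_nn_integral[OF k]) (unfold indicator_def mem_Collect_eq, measurable)
  have [measurable]: "(\<lambda>w. rim_share e (k w) (u w) (x w)) \<in> borel_measurable \<Omega>"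
    unfolding rim_share_def by measurable
  show "(\<lambda>(w, y). fill e (k w) (u w) (x w) y) \<in> borel_measurable (\<Omega> \<Otimes>\<^sub>M borel)"
    unfolding fill_def by measurable
qed

section \<open>Inner mass, rim mass and rim share of a single profile\<close>

locale mass_profile =
  fixes \<mu> :: "'a::euclidean_space measure" and u :: "'a \<Rightarrow> real"
  assumes lf: "locally_finite_borel \<mu>"
    and meas: "u \<in> borel_measurable borel"
    and nonneg: "\<And>y. 0 \<le> u y" and le_one: "\<And>y. u y \<le> 1"
begin

lemma sets_mu [simp, measurable_cong]: "sets \<mu> = sets borel"
  using lf by (rule sets_locally_finite_borel)

lemma space_mu [simp]: "space \<mu> = UNIV"
  using lf by (rule space_locally_finite_borel)

lemma u_measurable [measurable]: "u \<in> borel_measurable borel"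
  by (rule meas)

abbreviation mass :: "'a set \<Rightarrow> ennreal" where
  "mass B \<equiv> (\<integral>\<^sup>+ y\<in>B. ennreal (u y) \<partial>\<mu>)"

lemma mass_eq_emeasure: "B \<in> sets borel \<Longrightarrow> mass B = emeasure (Nonnegative_Lebesgue_Integration.density \<mu> (\<lambda>y. ennreal (u y))) B"
  by (simp add: emeasure_density)

lemma mass_mono: "B \<subseteq> C \<Longrightarrow> mass B \<le> mass C"
  by (intro nn_integral_mono) (auto simp: indicator_def)

lemma mass_cball_finite: "mass (cball x a) < \<infinity>"
proof -
  have "mass (cball x a) \<le> (\<integral>\<^sup>+ y. indicator (cball x a) y \<partial>\<mu>)"
    using le_one by (intro nn_integral_mono) (auto simp: indicator_def)
  also have "\<dots> < \<infinity>"
    using lf by (simp add: locally_finite_borel_def)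
  finally show ?thesis .
qed

lemma mass_le_one_of_less_radius: 
  assumes "ereal a < fill_radius \<mu> u x" shows "mass (cball x a) \<le> 1"
proof -
  obtain b where b: "mass (cball x b) \<le> 1" "a < b"
    using assms by (auto simp: fill_radius_def less_SUP_iff)
  have "mass (cball x a) \<le> mass (cball x b)" using b(2) by (intro mass_mono) auto
  then show ?thesis using b(1) by simp
qed

lemma mass_gr_one_of_gr_radius:
  assumes "fill_radius \<mu> u x < ereal a" shows "1 < mass (cball x a)"
proof (rule ccontr)
  assume "\<not> 1 < mass (cball x a)"
  then have "ereal a \<le> fill_radius \<mu> u x"
    unfolding fill_radius_def by (intro SUP_upper) simp
  with assms show False by simp
qed

lemma fill_radius_nonneg: "0 \<le> fill_radius \<mu> u x"
proof (rule ccontr)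
  assume "\<not> 0 \<le> fill_radius \<mu> u x"
  then obtain a where "fill_radius \<mu> u x < ereal a" "ereal a < 0"
    using ereal_dense2[of "fill_radius \<mu> u x" 0] by (metis not_le)
  with mass_gr_one_of_gr_radius[of x a] show False by simp
qed

text \<open>Continuity from below: closed balls of radii strictly below \<open>fill_radius\<close>
  have mass at most 1 and fill up the region. Approximation in the extended reals treats radius 0,
  where all these balls are empty, and radius \<open>\<infinity>\<close> uniformly.\<close>

lemma inner_mass_le_one: "inner_mass \<mu> u x \<le> 1"
proof -
  define r where "r = fill_radius \<mu> u x"
  have "- \<infinity> < r" using fill_radius_nonneg[of x] by (auto simp: r_def)
  then obtain b :: "nat \<Rightarrow> real" where b: "incseq b" "\<And>i. ereal (b i) < r" "(\<lambda>i. ereal (b i)) \<longlonglongrightarrow> r"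
    using ereal_incseq_approx by metis
  have "\<exists>i. ereal (dist x y) \<le> ereal (b i)" if "ereal (dist x y) < r" for y
    using order_tendstoD(1)[OF b(3) that] by (auto simp: eventually_sequentially intro: less_imp_le)
  moreover have "ereal (dist x y) < r" if "dist x y \<le> b i" for y i
    using that b(2)[of i] by (metis ereal_less_eq(3) order_le_less_trans)
  ultimately have eq: "{y. ereal (dist x y) < r} = (\<Union>i. cball x (b i))"
    by auto
  have "incseq (\<lambda>i. cball x (b i))"
    using b(1) unfolding incseq_def by (meson subset_cball)
  then have "mass (\<Union>i. cball x (b i)) = (SUP i. mass (cball x (b i)))"
    by (subst (1 2) mass_eq_emeasure) (auto intro!: SUP_emeasure_incseq[symmetric])
  also have "\<dots> \<le> 1"
    using b(2) by (auto intro!: SUP_least mass_le_one_of_less_radius simp: r_def)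
  finally show ?thesis
    by (simp add: inner_mass_def r_def flip: eq)
qed

lemma rim_mass_finite: "rim_mass \<mu> u x < \<infinity>"
proof (cases "fill_radius \<mu> u x")
  case (real \<rho>)
  have "rim_mass \<mu> u x \<le> mass (cball x \<rho>)"
    unfolding rim_mass_def real by (rule mass_mono) auto
  then show ?thesis using mass_cball_finite[of x \<rho>] by simp
qed (simp_all add: rim_mass_def)

lemma mass_cball_fill_radius:
  assumes "fill_radius \<mu> u x = ereal \<rho>"
  shows "mass (cball x \<rho>) = inner_mass \<mu> u x + rim_mass \<mu> u x"
proof -
  have "cball x \<rho> = ball x \<rho> \<union> sphere x \<rho>" by auto
  moreover have "mass (ball x \<rho> \<union> sphere x \<rho>) = mass (ball x \<rho>) + mass (sphere x \<rho>)"
    by (subst (1 2 3) mass_eq_emeasure) (auto intro!: plus_emeasure[symmetric])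
  ultimately show ?thesis
    by (simp add: inner_mass_def rim_mass_def assms ball_def sphere_def)
qed

text \<open>Continuity from above: all larger closed balls have mass above 1 and shrink to this one.
  Local finiteness makes their masses finite, as the decreasing limit requires.\<close>

lemma one_le_mass_cball_fill_radius:
  assumes "fill_radius \<mu> u x = ereal \<rho>"
  shows "1 \<le> mass (cball x \<rho>)"
proof -
  have "ereal \<rho> < \<infinity>" by simp
  then obtain b :: "nat \<Rightarrow> real" where b: "decseq b" "\<And>i. ereal \<rho> < ereal (b i)" "(\<lambda>i. ereal (b i)) \<longlonglongrightarrow> ereal \<rho>"
    using ereal_decseq_approx by metis
  have eq: "(\<Inter>i. cball x (b i)) = cball x \<rho>"
  proof (intro antisym subsetI)
    fix y assume "y \<in> (\<Inter>i. cball x (b i))"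
    then have "ereal (dist x y) \<le> ereal \<rho>"
      by (intro LIMSEQ_le_const[OF b(3)]) auto
    then show "y \<in> cball x \<rho>" by simp
  next
    fix y assume "y \<in> cball x \<rho>"
    then show "y \<in> (\<Inter>i. cball x (b i))"
      using b(2) by (auto intro: order_trans less_imp_le)
  qed
  have dec: "decseq (\<lambda>i. cball x (b i))"
    using b(1) unfolding decseq_def by (meson subset_cball)
  have "(INF i. mass (cball x (b i))) = mass (\<Inter>i. cball x (b i))"
    using dec mass_cball_finite[of x "b _"] unfolding mass_eq_emeasure[OF borel_closed[OF closed_cball]] eq[symmetric]
    by (subst mass_eq_emeasure)
      (auto intro!: INF_emeasure_decseq simp: less_top[symmetric])
  moreover have "1 \<le> (INF i. mass (cball x (b i)))"
    using b(2) assms by (intro INF_greatest less_imp_le mass_gr_one_of_gr_radius) auto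
  ultimately show ?thesis by (simp add: eq)
qed

text \<open>With inner mass \<open>B\<close> and rim mass \<open>S\<close> the previous bounds read
  \<open>B \<le> 1 \<le> B + S\<close>. So \<open>(1 - B) / S\<close> lies in the unit interval if
  \<open>S > 0\<close>, while \<open>S = 0\<close> forces \<open>B = 1\<close>, and then any share
  completes the mass.\<close>

lemma rim_share_props:
  assumes e: "0 \<le> e" "e \<le> 1" and r: "fill_radius \<mu> u x \<noteq> \<infinity>"
  shows rim_share_nonneg: "0 \<le> rim_share e \<mu> u x" and rim_share_le_one: "rim_share e \<mu> u x \<le> 1"
    and inner_plus_rim: "enn2real (inner_mass \<mu> u x) + rim_share e \<mu> u x * enn2real (rim_mass \<mu> u x) = 1"
proof -
  obtain \<rho> where \<rho>: "fill_radius \<mu> u x = ereal \<rho>"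
    using r fill_radius_nonneg[of x] by (cases "fill_radius \<mu> u x") auto
  obtain B where B: "inner_mass \<mu> u x = ennreal B" "0 \<le> B" "B \<le> 1"
    using inner_mass_le_one[of x] by (cases "inner_mass \<mu> u x") (auto simp: ennreal_le_1 top_unique)
  obtain S where S: "rim_mass \<mu> u x = ennreal S" "0 \<le> S"
    using rim_mass_finite[of x] by (cases "rim_mass \<mu> u x") auto
  have BS: "1 \<le> B + S"
    using one_le_mass_cball_fill_radius[OF \<rho>] B S
    by (simp add: mass_cball_fill_radius[OF \<rho>] flip: ennreal_plus)
  show "0 \<le> rim_share e \<mu> u x" "rim_share e \<mu> u x \<le> 1"
    "enn2real (inner_mass \<mu> u x) + rim_share e \<mu> u x * enn2real (rim_mass \<mu> u x) = 1"
    using B S BS e by (auto simp: rim_share_def divide_simps)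
qed

text \<open>The function \<open>v\<close> serves the site update: beyond the radius its integrand is
  \<open>- R x \<eta>\<close>, which \<open>ennreal\<close> sends to 0.\<close>

lemma nn_integral_partial_fill:
  assumes w: "0 \<le> w" and v: "\<And>y. v y \<le> 0"
  shows "(\<integral>\<^sup>+ y. ennreal (if ereal (dist x y) < fill_radius \<mu> u x then u y
            else if ereal (dist x y) = fill_radius \<mu> u x then w * u y else v y) \<partial>\<mu>) =
         inner_mass \<mu> u x + ennreal w * rim_mass \<mu> u x" (is "(\<integral>\<^sup>+ y. ?f y \<partial>\<mu>) = _")
proof -
  have "(\<integral>\<^sup>+ y. ?f y \<partial>\<mu>) = (\<integral>\<^sup>+ y. ennreal (u y) * indicator {y. ereal (dist x y) < fill_radius \<mu> u x} y +
      ennreal w * (ennreal (u y) * indicator {y. ereal (dist x y) = fill_radius \<mu> u x} y) \<partial>\<mu>)"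
    using w v nonneg by (intro nn_integral_cong) (auto simp: indicator_def ennreal_mult ennreal_neg)
  also have "\<dots> = inner_mass \<mu> u x + ennreal w * rim_mass \<mu> u x"
    unfolding inner_mass_def rim_mass_def
    by (subst nn_integral_add; (subst nn_integral_cmult)?) measurable
  finally show ?thesis .
qed

lemma nn_integral_fill_eq_one:
  assumes e: "0 \<le> e" "e \<le> 1" and r: "fill_radius \<mu> u x \<noteq> \<infinity>"
  shows "(\<integral>\<^sup>+ y. ennreal (fill e \<mu> u x y) \<partial>\<mu>) = 1"
proof -
  have "(\<integral>\<^sup>+ y. ennreal (fill e \<mu> u x y) \<partial>\<mu>) = inner_mass \<mu> u x + ennreal (rim_share e \<mu> u x) * rim_mass \<mu> u x"
    unfolding fill_def by (rule nn_integral_partial_fill) (simp_all add: rim_share_nonneg[OF e r])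
  also have "\<dots> = ennreal (enn2real (inner_mass \<mu> u x) + rim_share e \<mu> u x * enn2real (rim_mass \<mu> u x))"
    using inner_mass_le_one[of x] rim_mass_finite[of x] rim_share_nonneg[OF e r]
    by (simp add: ennreal_mult le_less_trans[of _ 1 top])
  finally show ?thesis by (simp add: inner_plus_rim[OF e r])
qed

lemma nn_integral_fill_le_one:
  assumes e: "0 \<le> e" "e \<le> 1"
  shows "(\<integral>\<^sup>+ y. ennreal (fill e \<mu> u x y) \<partial>\<mu>) \<le> 1"
proof (cases "fill_radius \<mu> u x = \<infinity>")
  case True
  then show ?thesis using inner_mass_le_one[of x] by (simp add: fill_def inner_mass_def)
qed (simp add: nn_integral_fill_eq_one[OF e])

lemma fill_nonneg: "0 \<le> e \<Longrightarrow> e \<le> 1 \<Longrightarrow> 0 \<le> fill e \<mu> u x y"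
  using rim_share_nonneg[of e x] nonneg[of y] by (cases "fill_radius \<mu> u x = \<infinity>") (auto simp: fill_def)

lemma fill_le: "0 \<le> e \<Longrightarrow> e \<le> 1 \<Longrightarrow> fill e \<mu> u x y \<le> u y"
  using rim_share_le_one[of e x] rim_share_nonneg[of e x] nonneg[of y]
  by (cases "fill_radius \<mu> u x = \<infinity>") (auto simp: fill_def mult_left_le_one_le)

text \<open>Under \<open>w = 1 - c\<close> this is the set over which \<open>A_upd\<close> takes a
  supremum and \<open>R_upd\<close> an infimum. The mass equation is affine in \<open>w\<close> with
  slope \<open>rim_mass \<mu> u x\<close>, so its solution is unique unless the slope is 0, and then
  every \<open>w\<close> solves it.\<close>

lemma rim_coefficients:
  assumes r: "fill_radius \<mu> u x \<noteq> \<infinity>"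
  shows "{w \<in> {0..1}. inner_mass \<mu> u x + ennreal w * rim_mass \<mu> u x = 1} =
         (if rim_mass \<mu> u x = 0 then {0..1} else {rim_share e \<mu> u x})"
proof -
  have fin: "inner_mass \<mu> u x = ennreal (enn2real (inner_mass \<mu> u x))"
    "rim_mass \<mu> u x = ennreal (enn2real (rim_mass \<mu> u x))"
    using inner_mass_le_one[of x] rim_mass_finite[of x] by (auto simp: le_less_trans[of _ 1 top])
  have *: "inner_mass \<mu> u x + ennreal w * rim_mass \<mu> u x = 1 \<longleftrightarrow>
      enn2real (inner_mass \<mu> u x) + w * enn2real (rim_mass \<mu> u x) = 1" if "w \<in> {0..1}" for w
    using that by (subst fin(1), subst fin(2)) (simp flip: ennreal_mult ennreal_plus ennreal_1)
  have eq: "{w \<in> {0..1}. inner_mass \<mu> u x + ennreal w * rim_mass \<mu> u x = 1} =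
      {w \<in> {0..1}. enn2real (inner_mass \<mu> u x) + w * enn2real (rim_mass \<mu> u x) = 1}"
    using * by auto
  show ?thesis
  proof (cases "rim_mass \<mu> u x = 0")
    case True
    then show ?thesis using inner_plus_rim[of 0 x] r unfolding eq by auto
  next
    case False
    have S: "enn2real (rim_mass \<mu> u x) \<noteq> 0" using False fin(2) by auto
    have "rim_share e \<mu> u x = rim_share 0 \<mu> u x" using False by (simp add: rim_share_def)
    then show ?thesis
      using inner_plus_rim[of 0 x] rim_share_nonneg[of 0 x] rim_share_le_one[of 0 x] r S False
      unfolding eq by (auto simp: rim_share_def field_simps)
  qed
qed

text \<open>The updates test whether the sphere is \<open>\<mu>\<close>-null, whereas
  \<open>rim_share\<close> tests its \<open>u\<close>-weighted mass. This links the two tests. On a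
  non-null sphere without weighted mass, the supremum or infimum over \<open>{0..1}\<close> yields
  the same default.\<close>

lemma rim_mass_eq_0:
  assumes "emeasure \<mu> (sphere x (real_of_ereal (fill_radius \<mu> u x))) = 0"
    and r: "fill_radius \<mu> u x \<noteq> \<infinity>"
  shows "rim_mass \<mu> u x = 0"
proof -
  obtain \<rho> where \<rho>: "fill_radius \<mu> u x = ereal \<rho>"
    using r fill_radius_nonneg[of x] by (cases "fill_radius \<mu> u x") auto
  have "rim_mass \<mu> u x \<le> (\<integral>\<^sup>+ y. indicator (sphere x \<rho>) y \<partial>\<mu>)"
    unfolding rim_mass_def \<rho> using le_one by (intro nn_integral_mono) (auto simp: indicator_def)
  then show ?thesis using assms(1) by (simp add: \<rho>)
qed

end

lemma fill_radius_antimono: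
  assumes "\<And>y. u y \<le> v y"
  shows "fill_radius \<mu> v x \<le> fill_radius \<mu> u x"
proof -
  have "(\<integral>\<^sup>+ y\<in>cball x a. ennreal (u y) \<partial>\<mu>) \<le> (\<integral>\<^sup>+ y\<in>cball x a. ennreal (v y) \<partial>\<mu>)" for a
    using assms by (intro nn_integral_mono) (auto simp: indicator_def ennreal_leI)
  then show ?thesis
    unfolding fill_radius_def by (intro Sup_subset_mono image_mono) (auto intro: order_trans)
qed

text \<open>The case to watch is a rim that is null for \<open>u\<close> but not for \<open>v\<close>: then the inner mass of
  \<open>u\<close>, and hence that of \<open>v\<close>, is already 1, so \<open>v\<close> has share 0.\<close>
lemma rim_share_antimono:
  assumes u: "mass_profile \<mu> u" and v: "mass_profile \<mu> v"
    and le: "\<And>y. u y \<le> v y" and r: "fill_radius \<mu> u x = fill_radius \<mu> v x" "fill_radius \<mu> u x \<noteq> \<infinity>"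
    and e: "0 \<le> e" "e \<le> 1"
  shows "rim_share e \<mu> v x \<le> rim_share e \<mu> u x"
proof -
  interpret u: mass_profile \<mu> u by fact
  interpret v: mass_profile \<mu> v by fact
  define B S where "B w = enn2real (inner_mass \<mu> w x)" and "S w = enn2real (rim_mass \<mu> w x)" for w
  have top: "inner_mass \<mu> v x < top" "rim_mass \<mu> v x < top" "rim_mass \<mu> u x < top"
    using v.inner_mass_le_one[of x] v.rim_mass_finite[of x] u.rim_mass_finite[of x]
    by (auto simp: le_less_trans[of _ 1 top])
  have S0: "S w = 0 \<longleftrightarrow> rim_mass \<mu> w x = 0" if "rim_mass \<mu> w x < top" for w
    using that by (auto simp: S_def enn2real_eq_0_iff)
  have B: "B u \<le> B v"
    unfolding B_def using top(1)
    by (intro enn2real_mono)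
      (auto simp: inner_mass_def r intro!: nn_integral_mono mult_right_mono ennreal_leI le)
  have S: "0 \<le> S u" "S u \<le> S v"
    unfolding S_def using top(2)
    by (auto simp: rim_mass_def r intro!: nn_integral_mono mult_right_mono ennreal_leI le enn2real_mono)
  have B1: "B v \<le> 1"
    using v.inner_mass_le_one[of x] unfolding B_def by (metis enn2real_1 enn2real_mono ennreal_one_less_top)
  have eq: "B u + rim_share e \<mu> u x * S u = 1" "B v + rim_share e \<mu> v x * S v = 1"
    using u.inner_plus_rim[OF e r(2)] v.inner_plus_rim[OF e] r by (auto simp: B_def S_def)
  show ?thesis
  proof (cases "S v = 0")
    case True
    then have "S u = 0" using S by simp
    with True have "rim_mass \<mu> v x = 0" "rim_mass \<mu> u x = 0" using S0 top by auto
    then show ?thesis by (simp add: rim_share_def)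
  next
    case Sv: False
    show ?thesis
    proof (cases "S u = 0")
      case True
      then have "rim_share e \<mu> v x * S v = 0" using eq B B1 by auto
      then show ?thesis using Sv u.rim_share_nonneg[OF e r(2)] by simp
    next
      case False
      \<comment> \<open>Both filled masses total 1 and \<open>v\<close> has at least the inner mass
        of \<open>u\<close>, so its rim contributes at most as much, although that rim is at least
        as heavy.\<close>
      have "rim_share e \<mu> v x * S u \<le> rim_share e \<mu> v x * S v"
        using S v.rim_share_nonneg[OF e] r by (intro mult_left_mono) auto
      also have "\<dots> \<le> rim_share e \<mu> u x * S u" using eq B by linarith
      finally show ?thesis using False S by (simp add: mult_le_cancel_right)
    qed
  qed
qed

subsection \<open>The stages of the algorithm\<close>

text \<open>The cutoff is genuine: \<open>A_upd\<close> is 0 beyond the radius even where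
  \<open>R\<close> is positive. Along the stages it disappears, see
  \<open>application_eq_fill\<close>.\<close>

lemma A_upd_eq_fill:
  assumes "mass_profile \<psi> (\<lambda>\<xi>. 1 - R x \<xi>)"
  shows "A_upd \<psi> R x \<xi> = (if ereal (dist x \<xi>) \<le> fill_radius \<psi> (\<lambda>\<xi>. 1 - R x \<xi>) x
           then R x \<xi> + fill 0 \<psi> (\<lambda>\<xi>. 1 - R x \<xi>) x \<xi> else 0)"
proof -
  define u where "u = (\<lambda>\<xi>. 1 - R x \<xi>)"
  interpret mass_profile \<psi> u using assms by (simp add: u_def)
  have R0: "0 \<le> R x \<eta>" for \<eta> using le_one[of \<eta>] by (simp add: u_def)
  define r where "r = fill_radius \<psi> u x"
  have r: "a_rad \<psi> R x = r" by (simp add: r_def a_rad_def fill_radius_def u_def)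
  define c where "c = (if r = \<infinity> \<or> emeasure \<psi> (sphere x (real_of_ereal r)) = 0 then 1
      else Sup {c \<in> {0..1}. (\<integral>\<^sup>+ \<eta>. ennreal ((if ereal (dist x \<eta>) < r then 1
                     else if ereal (dist x \<eta>) = r then c * R x \<eta> + 1 - c else 0) - R x \<eta>) \<partial>\<psi>) = 1})"
  have upd: "A_upd \<psi> R x \<xi> = (if ereal (dist x \<xi>) < r then 1
      else if ereal (dist x \<xi>) = r then c * R x \<xi> + 1 - c else 0)"
    unfolding A_upd_def r Let_def c_def by (rule refl)
  have c: "c = 1 - rim_share 0 \<psi> u x" if fin: "r \<noteq> \<infinity>"
  proof (cases "emeasure \<psi> (sphere x (real_of_ereal r)) = 0")
    case True
    then show ?thesis using rim_mass_eq_0[of x] fin by (simp add: c_def rim_share_def r_def)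
  next
    case False
    have int: "(\<integral>\<^sup>+ \<eta>. ennreal ((if ereal (dist x \<eta>) < r then 1
        else if ereal (dist x \<eta>) = r then c * R x \<eta> + 1 - c else 0) - R x \<eta>) \<partial>\<psi>) =
        inner_mass \<psi> u x + ennreal (1 - c) * rim_mass \<psi> u x" if "c \<in> {0..1}" for c
    proof -
      \<comment> \<open>On the rim \<open>c * R x \<eta> + 1 - c - R x \<eta>\<close> factors as
        \<open>(1 - c) * u \<eta>\<close>, so the share taken is \<open>1 - c\<close>.\<close>
      have "(\<integral>\<^sup>+ \<eta>. ennreal ((if ereal (dist x \<eta>) < r then 1
          else if ereal (dist x \<eta>) = r then c * R x \<eta> + 1 - c else 0) - R x \<eta>) \<partial>\<psi>) =
        (\<integral>\<^sup>+ \<eta>. ennreal (if ereal (dist x \<eta>) < r then u \<eta>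
            else if ereal (dist x \<eta>) = r then (1 - c) * u \<eta> else - R x \<eta>) \<partial>\<psi>)"
        by (intro nn_integral_cong arg_cong[where f = ennreal]) (simp add: u_def algebra_simps)
      also have "\<dots> = inner_mass \<psi> u x + ennreal (1 - c) * rim_mass \<psi> u x"
        unfolding r_def using that R0 by (intro nn_integral_partial_fill) auto
      finally show ?thesis .
    qed
    have "c = Sup {c \<in> {0..1}. inner_mass \<psi> u x + ennreal (1 - c) * rim_mass \<psi> u x = 1}"
      using False fin int by (simp add: c_def cong: conj_cong)
    also have "{c \<in> {0..1}. inner_mass \<psi> u x + ennreal (1 - c) * rim_mass \<psi> u x = 1} =
        (\<lambda>w. 1 - w) ` {w \<in> {0..1}. inner_mass \<psi> u x + ennreal w * rim_mass \<psi> u x = 1}"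
      by (auto intro!: image_eqI[of _ _ "1 - _"])
    \<comment> \<open>On a rim without mass all of \<open>{0..1}\<close> is admissible and its
      supremum is 1; this is the share 0 prescribed by \<open>e = 0\<close>.\<close>
    also have "\<dots> = (if rim_mass \<psi> u x = 0 then {0..1} else {1 - rim_share 0 \<psi> u x})"
      unfolding rim_coefficients[OF fin[unfolded r_def], where e = 0] by simp
    finally show ?thesis by (simp add: rim_share_def split: if_splits)
  qed
  show ?thesis
  proof (cases "ereal (dist x \<xi>) = r")
    case True
    then have "r \<noteq> \<infinity>" by auto
    then show ?thesis
      using True unfolding upd c[OF \<open>r \<noteq> \<infinity>\<close>] u_def[symmetric] r_def[symmetric] fill_def
      by (simp add: u_def algebra_simps)
  next
    case False
    then show ?thesis
      unfolding upd u_def[symmetric] r_def[symmetric] fill_def by (auto simp: u_def)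
  qed
qed

text \<open>No cutoff arises here: beyond the radius everything is rejected, so \<open>R_upd\<close>
  equals \<open>A\<close> and \<open>fill\<close> vanishes.\<close>

lemma R_upd_eq_fill:
  assumes "mass_profile \<phi> (\<lambda>y. A y \<xi>)"
  shows "R_upd \<phi> A x \<xi> = A x \<xi> - fill 1 \<phi> (\<lambda>y. A y \<xi>) \<xi> x"
proof -
  define u where "u = (\<lambda>y. A y \<xi>)"
  interpret mass_profile \<phi> u using assms by (simp add: u_def)
  define r where "r = fill_radius \<phi> u \<xi>"
  have r: "r_rad \<phi> A \<xi> = r" by (simp add: r_def r_rad_def fill_radius_def u_def)
  define c where "c = (if r = \<infinity> \<or> emeasure \<phi> (sphere \<xi> (real_of_ereal r)) = 0 then 0
      else Inf {c \<in> {0..1}. (\<integral>\<^sup>+ y. ennreal (A y \<xi> - (if ereal (dist y \<xi>) < r then 0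
                     else if ereal (dist y \<xi>) = r then c * A y \<xi> else A y \<xi>)) \<partial>\<phi>) = 1})"
  have upd: "R_upd \<phi> A x \<xi> = (if ereal (dist x \<xi>) < r then 0
      else if ereal (dist x \<xi>) = r then c * A x \<xi> else A x \<xi>)"
    unfolding R_upd_def r Let_def c_def by (rule refl)
  have c: "c = 1 - rim_share 1 \<phi> u \<xi>" if fin: "r \<noteq> \<infinity>"
  proof (cases "emeasure \<phi> (sphere \<xi> (real_of_ereal r)) = 0")
    case True
    then show ?thesis using rim_mass_eq_0[of \<xi>] fin by (simp add: c_def rim_share_def r_def)
  next
    case False
    have int: "(\<integral>\<^sup>+ y. ennreal (A y \<xi> - (if ereal (dist y \<xi>) < r then 0
        else if ereal (dist y \<xi>) = r then c * A y \<xi> else A y \<xi>)) \<partial>\<phi>) =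
        inner_mass \<phi> u \<xi> + ennreal (1 - c) * rim_mass \<phi> u \<xi>" if "c \<in> {0..1}" for c
    proof -
      have "(\<integral>\<^sup>+ y. ennreal (A y \<xi> - (if ereal (dist y \<xi>) < r then 0
          else if ereal (dist y \<xi>) = r then c * A y \<xi> else A y \<xi>)) \<partial>\<phi>) =
        (\<integral>\<^sup>+ y. ennreal (if ereal (dist \<xi> y) < r then u y
            else if ereal (dist \<xi> y) = r then (1 - c) * u y else 0) \<partial>\<phi>)"
        by (intro nn_integral_cong arg_cong[where f = ennreal])
          (simp add: u_def algebra_simps dist_commute)
      also have "\<dots> = inner_mass \<phi> u \<xi> + ennreal (1 - c) * rim_mass \<phi> u \<xi>"
        unfolding r_def using that by (intro nn_integral_partial_fill) auto
      finally show ?thesis .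
    qed
    have "c = Inf {c \<in> {0..1}. inner_mass \<phi> u \<xi> + ennreal (1 - c) * rim_mass \<phi> u \<xi> = 1}"
      using False fin int by (simp add: c_def cong: conj_cong)
    also have "{c \<in> {0..1}. inner_mass \<phi> u \<xi> + ennreal (1 - c) * rim_mass \<phi> u \<xi> = 1} =
        (\<lambda>w. 1 - w) ` {w \<in> {0..1}. inner_mass \<phi> u \<xi> + ennreal w * rim_mass \<phi> u \<xi> = 1}"
      by (auto intro!: image_eqI[of _ _ "1 - _"])
    \<comment> \<open>Now the infimum 0 of \<open>{0..1}\<close> is taken on a rim without mass;
      this is the share 1 prescribed by \<open>e = 1\<close>.\<close>
    also have "\<dots> = (if rim_mass \<phi> u \<xi> = 0 then {0..1} else {1 - rim_share 1 \<phi> u \<xi>})"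
      unfolding rim_coefficients[OF fin[unfolded r_def], where e = 1] by simp
    finally show ?thesis by (simp add: rim_share_def split: if_splits)
  qed
  show ?thesis
  proof (cases "ereal (dist \<xi> x) = r")
    case True
    then have "r \<noteq> \<infinity>" by auto
    then show ?thesis
      using True unfolding upd c[OF \<open>r \<noteq> \<infinity>\<close>] u_def[symmetric] r_def[symmetric] fill_def
      by (simp add: u_def algebra_simps dist_commute)
  next
    case False
    then show ?thesis
      unfolding upd u_def[symmetric] r_def[symmetric] fill_def by (auto simp: u_def dist_commute)
  qed
qed

section \<open>Bounds and monotonicity of the two updates\<close>

lemma A_upd_bounds:
  assumes "mass_profile \<psi> (\<lambda>\<xi>. 1 - R x \<xi>)"
  shows "0 \<le> A_upd \<psi> R x \<xi>" "A_upd \<psi> R x \<xi> \<le> 1"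
proof -
  interpret mass_profile \<psi> "\<lambda>\<xi>. 1 - R x \<xi>" by fact
  show "0 \<le> A_upd \<psi> R x \<xi>" "A_upd \<psi> R x \<xi> \<le> 1"
    using fill_nonneg[of 0 x \<xi>] fill_le[of 0 x \<xi>] le_one[of \<xi>] by (auto simp: A_upd_eq_fill[where R = R and x = x, OF assms])
qed

lemma R_upd_bounds:
  assumes "mass_profile \<phi> (\<lambda>y. A y \<xi>)"
  shows "0 \<le> R_upd \<phi> A x \<xi>" "R_upd \<phi> A x \<xi> \<le> A x \<xi>"
proof -
  interpret mass_profile \<phi> "\<lambda>y. A y \<xi>" by fact
  show "0 \<le> R_upd \<phi> A x \<xi>" "R_upd \<phi> A x \<xi> \<le> A x \<xi>"
    using fill_nonneg[of 1 \<xi> x] fill_le[of 1 \<xi> x] by (auto simp: R_upd_eq_fill[where A = A and \<xi> = \<xi>, OF assms])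
qed

text \<open>A larger \<open>R\<close> leaves a smaller profile \<open>1 - R\<close>, hence a larger
  radius. Beyond the old radius the old value is 0 and inside the new one the new value is 1, so
  only a common rim remains. There the value is \<open>1 - (1 - w) * u\<close> with share
  \<open>w\<close>, and \<open>w\<close> can only grow while \<open>u\<close> can only
  shrink.\<close>

lemma A_upd_mono:
  assumes R: "mass_profile \<psi> (\<lambda>\<xi>. 1 - R x \<xi>)" and R': "mass_profile \<psi> (\<lambda>\<xi>. 1 - R' x \<xi>)"
    and le: "\<And>\<xi>. R x \<xi> \<le> R' x \<xi>"
  shows "A_upd \<psi> R x \<xi> \<le> A_upd \<psi> R' x \<xi>"
proof -
  define u u' where "u = (\<lambda>\<xi>. 1 - R x \<xi>)" and "u' = (\<lambda>\<xi>. 1 - R' x \<xi>)"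
  interpret u: mass_profile \<psi> u using R by (simp add: u_def)
  interpret u': mass_profile \<psi> u' using R' by (simp add: u'_def)
  have rad: "fill_radius \<psi> u x \<le> fill_radius \<psi> u' x"
    by (rule fill_radius_antimono) (simp add: u_def u'_def le)
  consider (out) "fill_radius \<psi> u x < ereal (dist x \<xi>)"
    | (inside) "ereal (dist x \<xi>) < fill_radius \<psi> u' x"
    | (rim) "fill_radius \<psi> u x = ereal (dist x \<xi>)" "fill_radius \<psi> u' x = ereal (dist x \<xi>)"
    using rad by (meson antisym not_le_imp_less order_trans)
  then show ?thesis
  proof cases
    case out
    then have "A_upd \<psi> R x \<xi> = 0" by (simp add: A_upd_eq_fill[where R = R and x = x, OF R] u_def)
    then show ?thesis using A_upd_bounds(1)[where R = R' and x = x, OF R'] by simp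
  next
    case inside
    then have "A_upd \<psi> R' x \<xi> = 1" by (simp add: A_upd_eq_fill[where R = R' and x = x, OF R'] fill_def u'_def)
    then show ?thesis using A_upd_bounds(2)[where R = R and x = x, OF R] by simp
  next
    case rim
    define w w' where "w = rim_share 0 \<psi> u x" and "w' = rim_share 0 \<psi> u' x"
    have w: "w \<le> w'"
      unfolding w_def w'_def
      using rim by (intro rim_share_antimono u.mass_profile_axioms u'.mass_profile_axioms)
        (auto simp: u_def u'_def le)
    have w1: "w' \<le> 1" using rim u'.rim_share_le_one[of 0 x] by (simp add: w'_def)
    have "(1 - w') * u' \<xi> \<le> (1 - w) * u \<xi>"
      using w w1 le[of \<xi>] u'.nonneg[of \<xi>] by (intro mult_mono) (auto simp: u_def u'_def)
    then show ?thesis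
      using rim by (simp add: A_upd_eq_fill[where R = R and x = x, OF R] A_upd_eq_fill[where R = R' and x = x, OF R'] fill_def
          flip: u_def u'_def w_def w'_def) (simp add: u_def u'_def algebra_simps)
  qed
qed

text \<open>Here the larger profile has the smaller radius. Beyond the new radius \<open>A'\<close>
  is rejected in full, and inside the old radius nothing of \<open>A\<close> is rejected. On a
  common rim the rejection is \<open>(1 - w) * u\<close> with share \<open>w\<close>, and neither
  factor decreases.\<close>

lemma R_upd_mono:
  assumes A: "mass_profile \<phi> (\<lambda>y. A y \<xi>)" and A': "mass_profile \<phi> (\<lambda>y. A' y \<xi>)"
    and le: "\<And>y. A y \<xi> \<le> A' y \<xi>"
  shows "R_upd \<phi> A x \<xi> \<le> R_upd \<phi> A' x \<xi>"
proof -
  define u u' where "u = (\<lambda>y. A y \<xi>)" and "u' = (\<lambda>y. A' y \<xi>)"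
  interpret u: mass_profile \<phi> u using A by (simp add: u_def)
  interpret u': mass_profile \<phi> u' using A' by (simp add: u'_def)
  have rad: "fill_radius \<phi> u' \<xi> \<le> fill_radius \<phi> u \<xi>"
    by (rule fill_radius_antimono) (simp add: u_def u'_def le)
  consider (out) "fill_radius \<phi> u' \<xi> < ereal (dist \<xi> x)"
    | (inside) "ereal (dist \<xi> x) < fill_radius \<phi> u \<xi>"
    | (rim) "fill_radius \<phi> u \<xi> = ereal (dist \<xi> x)" "fill_radius \<phi> u' \<xi> = ereal (dist \<xi> x)"
    using rad by (meson antisym not_le_imp_less order_trans)
  then show ?thesis
  proof cases
    case out
    then have "R_upd \<phi> A' x \<xi> = A' x \<xi>" by (simp add: R_upd_eq_fill[where A = A' and \<xi> = \<xi>, OF A'] fill_def u'_def not_less less_imp_le less_imp_neq[symmetric])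
    then show ?thesis using R_upd_bounds(2)[where A = A and \<xi> = \<xi> and x = x, OF A] le[of x] by simp
  next
    case inside
    then have "R_upd \<phi> A x \<xi> = 0" by (simp add: R_upd_eq_fill[where A = A and \<xi> = \<xi>, OF A] fill_def u_def)
    then show ?thesis using R_upd_bounds(1)[where A = A' and \<xi> = \<xi>, OF A'] by simp
  next
    case rim
    define w w' where "w = rim_share 1 \<phi> u \<xi>" and "w' = rim_share 1 \<phi> u' \<xi>"
    have w: "w' \<le> w"
      unfolding w_def w'_def
      using rim by (intro rim_share_antimono u.mass_profile_axioms u'.mass_profile_axioms)
        (auto simp: u_def u'_def le)
    have w1: "w \<le> 1" using rim u.rim_share_le_one[of 1 \<xi>] by (simp add: w_def)
    have "(1 - w) * u x \<le> (1 - w') * u' x"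
      using w w1 le[of x] u.nonneg[of x] by (intro mult_mono) (auto simp: u_def u'_def)
    then show ?thesis
      using rim by (simp add: R_upd_eq_fill[where A = A and \<xi> = \<xi>, OF A] R_upd_eq_fill[where A = A' and \<xi> = \<xi>, OF A'] fill_def
          flip: u_def u'_def w_def w'_def) (simp add: u_def u'_def algebra_simps)
  qed
qed

section \<open>Joint measurability and bounds of the stages\<close>

abbreviation stage_A :: "'a::euclidean_space measure \<Rightarrow> 'a measure \<Rightarrow> nat \<Rightarrow> 'a \<Rightarrow> 'a \<Rightarrow> real" where
  "stage_A \<phi> \<psi> n \<equiv> fst (so_stages \<phi> \<psi> n)"

abbreviation stage_R :: "'a::euclidean_space measure \<Rightarrow> 'a measure \<Rightarrow> nat \<Rightarrow> 'a \<Rightarrow> 'a \<Rightarrow> real" where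
  "stage_R \<phi> \<psi> n \<equiv> snd (so_stages \<phi> \<psi> n)"

lemma stage_A_Suc: "stage_A \<phi> \<psi> (Suc n) = A_upd \<psi> (stage_R \<phi> \<psi> n)"
  and stage_R_Suc: "stage_R \<phi> \<psi> (Suc n) = R_upd \<phi> (stage_A \<phi> \<psi> (Suc n))"
  by (simp_all add: Let_def)

declare so_stages.simps(2) [simp del]

abbreviation config_space where
  "config_space \<equiv> (lf_measures \<Otimes>\<^sub>M lf_measures) \<Otimes>\<^sub>M (borel \<Otimes>\<^sub>M (borel :: 'a::euclidean_space measure))"

abbreviation on_config ::
  "('a::euclidean_space measure \<Rightarrow> 'a measure \<Rightarrow> 'a \<Rightarrow> 'a \<Rightarrow> real) \<Rightarrow>
    ('a measure \<times> 'a measure) \<times> ('a \<times> 'a) \<Rightarrow> real" where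
  "on_config F \<equiv> (\<lambda>p. F (fst (fst p)) (snd (fst p)) (fst (snd p)) (snd (snd p)))"

lemma
  assumes F: "on_config F \<in> borel_measurable config_space"
    and lf: "locally_finite_borel \<phi>" "locally_finite_borel \<psi>"
  shows config_section: "(\<lambda>(x, \<xi>). F \<phi> \<psi> x \<xi>) \<in> borel_measurable (borel \<Otimes>\<^sub>M borel)"
    and config_section_site: "(\<lambda>x. F \<phi> \<psi> x \<xi>) \<in> borel_measurable borel"
    and config_section_center: "(\<lambda>\<xi>. F \<phi> \<psi> x \<xi>) \<in> borel_measurable borel"
proof -
  have "(\<phi>, \<psi>) \<in> space (lf_measures \<Otimes>\<^sub>M lf_measures)"
    using lf by (simp add: space_pair_measure space_lf_measures)
  from measurable_Pair2[OF F this]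
  show *: "(\<lambda>(x, \<xi>). F \<phi> \<psi> x \<xi>) \<in> borel_measurable (borel \<Otimes>\<^sub>M borel)"
    by (simp add: case_prod_unfold)
  show "(\<lambda>x. F \<phi> \<psi> x \<xi>) \<in> borel_measurable borel" "(\<lambda>\<xi>. F \<phi> \<psi> x \<xi>) \<in> borel_measurable borel"
    using measurable_Pair1[OF *, of \<xi>] measurable_Pair2[OF *, of x] by simp_all
qed

text \<open>Bounds and measurability advance together: the formulas by \<open>fill\<close> are
  proved for measurable profiles with values in the unit interval, and measurability of the next
  stage is read off from these formulas.\<close>

lemma stage_invariants:
  "on_config (\<lambda>\<phi> \<psi>. stage_A \<phi> \<psi> n) \<in> borel_measurable (config_space :: (_ \<times> 'a \<times> 'a::euclidean_space) measure) \<and>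
   on_config (\<lambda>\<phi> \<psi>. stage_R \<phi> \<psi> n) \<in> borel_measurable (config_space :: (_ \<times> 'a \<times> 'a) measure) \<and>
   (\<forall>\<phi> \<psi> x \<xi>. locally_finite_borel \<phi> \<longrightarrow> locally_finite_borel \<psi> \<longrightarrow>
     0 \<le> stage_R \<phi> \<psi> n x (\<xi> :: 'a) \<and> stage_R \<phi> \<psi> n x \<xi> \<le> stage_A \<phi> \<psi> n x \<xi> \<and> stage_A \<phi> \<psi> n x \<xi> \<le> 1)"
proof (induction n)
  case 0
  then show ?case by simp
next
  case (Suc n)
  let ?P = "(lf_measures \<Otimes>\<^sub>M lf_measures) \<Otimes>\<^sub>M (borel :: 'a measure)"
  from Suc have R_meas [measurable]: "on_config (\<lambda>\<phi> \<psi>. stage_R \<phi> \<psi> n) \<in> borel_measurable (config_space :: (_ \<times> 'a \<times> 'a) measure)"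
    and bounds: "\<And>\<phi> \<psi> x \<xi>::'a. locally_finite_borel \<phi> \<Longrightarrow> locally_finite_borel \<psi> \<Longrightarrow>
      0 \<le> stage_R \<phi> \<psi> n x \<xi> \<and> stage_R \<phi> \<psi> n x \<xi> \<le> stage_A \<phi> \<psi> n x \<xi> \<and> stage_A \<phi> \<psi> n x \<xi> \<le> 1"
    by blast+
  have prof_R: "mass_profile \<psi> (\<lambda>\<xi>. 1 - stage_R \<phi> \<psi> n x \<xi>)"
    if "locally_finite_borel \<phi>" "locally_finite_borel \<psi>" for \<phi> \<psi> and x :: 'a
    using config_section_center[OF R_meas that] bounds[OF that] that
    by unfold_locales (auto intro: order_trans)
  have A_bounds: "0 \<le> stage_A \<phi> \<psi> (Suc n) x \<xi>" "stage_A \<phi> \<psi> (Suc n) x \<xi> \<le> 1"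
    if "locally_finite_borel \<phi>" "locally_finite_borel \<psi>" for \<phi> \<psi> and x \<xi> :: 'a
    unfolding stage_A_Suc using A_upd_bounds[where R = "stage_R _ _ n", OF prof_R[OF that]] by blast+
  have A_meas [measurable]: "on_config (\<lambda>\<phi> \<psi>. stage_A \<phi> \<psi> (Suc n)) \<in> borel_measurable (config_space :: (_ \<times> 'a \<times> 'a) measure)"
  proof -
    \<comment> \<open>The kernel parameter consists of the two measures and the site; the center is
      the integration variable.\<close>
    define u where "u = (\<lambda>w \<xi>. 1 - stage_R (fst (fst w)) (snd (fst w)) n (snd w) (\<xi> :: 'a))"
    have [measurable]: "case_prod u \<in> borel_measurable (?P \<Otimes>\<^sub>M borel)"
      using measurable_compose[OF _ R_meas, of "\<lambda>(w, \<xi>). (fst w, (snd w, \<xi>))" "?P \<Otimes>\<^sub>M borel"]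
      by (simp add: u_def case_prod_unfold)
    have k: "(\<lambda>w. snd (fst w)) \<in> measurable ?P lf_measures" by measurable
    have [measurable]: "(\<lambda>p. fill_radius (snd (fst p)) (u (fst p, fst (snd p))) (fst (snd p)))
        \<in> borel_measurable (config_space :: (_ \<times> 'a \<times> 'a) measure)"
      using measurable_compose[OF _ measurable_fill_radius[OF k, of snd u], of "\<lambda>p. (fst p, fst (snd p))" config_space]
      by simp
    have [measurable]: "(\<lambda>p. fill 0 (snd (fst p)) (u (fst p, fst (snd p))) (fst (snd p)) (snd (snd p)))
        \<in> borel_measurable (config_space :: (_ \<times> 'a \<times> 'a) measure)"
      using measurable_compose[OF _ measurable_fill[OF k, of snd u 0], of "\<lambda>p. ((fst p, fst (snd p)), snd (snd p))" config_space]
      by simp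
    \<comment> \<open>The formula is available at locally finite measures, and these are exactly the
      ones in the space, so congruence on the space suffices.\<close>
    have eq: "stage_A (fst (fst p)) (snd (fst p)) (Suc n) (fst (snd p)) (snd (snd p)) =
        (if ereal (dist (fst (snd p)) (snd (snd p))) \<le> fill_radius (snd (fst p)) (u (fst p, fst (snd p))) (fst (snd p))
         then stage_R (fst (fst p)) (snd (fst p)) n (fst (snd p)) (snd (snd p)) +
           fill 0 (snd (fst p)) (u (fst p, fst (snd p))) (fst (snd p)) (snd (snd p)) else 0)"
      if "p \<in> space config_space" for p
      using that prof_R[of "fst (fst p)" "snd (fst p)" "fst (snd p)"]
      by (simp add: stage_A_Suc A_upd_eq_fill u_def space_pair_measure space_lf_measures mem_Times_iff)
    show ?thesis by (subst measurable_cong[OF eq]) measurable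
  qed
  have prof_A: "mass_profile \<phi> (\<lambda>x. stage_A \<phi> \<psi> (Suc n) x \<xi>)"
    if "locally_finite_borel \<phi>" "locally_finite_borel \<psi>" for \<phi> \<psi> and \<xi> :: 'a
    using config_section_site[OF A_meas that] A_bounds[OF that] that
    by unfold_locales auto
  have R_bounds: "0 \<le> stage_R \<phi> \<psi> (Suc n) x \<xi>" "stage_R \<phi> \<psi> (Suc n) x \<xi> \<le> stage_A \<phi> \<psi> (Suc n) x \<xi>"
    if "locally_finite_borel \<phi>" "locally_finite_borel \<psi>" for \<phi> \<psi> and x \<xi> :: 'a
    unfolding stage_R_Suc using R_upd_bounds[where A = "stage_A _ _ (Suc n)", OF prof_A[OF that]] by blast+
  have "on_config (\<lambda>\<phi> \<psi>. stage_R \<phi> \<psi> (Suc n)) \<in> borel_measurable (config_space :: (_ \<times> 'a \<times> 'a) measure)"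
  proof -
    \<comment> \<open>The roles are exchanged: the center joins the parameter and the site is
      integrated against \<open>\<phi>\<close>.\<close>
    define u where "u = (\<lambda>w x. stage_A (fst (fst w)) (snd (fst w)) (Suc n) x (snd w :: 'a))"
    have [measurable]: "case_prod u \<in> borel_measurable (?P \<Otimes>\<^sub>M borel)"
      using measurable_compose[OF _ A_meas, of "\<lambda>(w, x). (fst w, (x, snd w))" "?P \<Otimes>\<^sub>M borel"]
      by (simp add: u_def case_prod_unfold)
    have k: "(\<lambda>w. fst (fst w)) \<in> measurable ?P lf_measures" by measurable
    have [measurable]: "(\<lambda>p. fill 1 (fst (fst p)) (u (fst p, snd (snd p))) (snd (snd p)) (fst (snd p)))
        \<in> borel_measurable (config_space :: (_ \<times> 'a \<times> 'a) measure)"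
      using measurable_compose[OF _ measurable_fill[OF k, of snd u 1], of "\<lambda>p. ((fst p, snd (snd p)), fst (snd p))" config_space]
      by simp
    have eq: "stage_R (fst (fst p)) (snd (fst p)) (Suc n) (fst (snd p)) (snd (snd p)) =
        stage_A (fst (fst p)) (snd (fst p)) (Suc n) (fst (snd p)) (snd (snd p)) -
           fill 1 (fst (fst p)) (u (fst p, snd (snd p))) (snd (snd p)) (fst (snd p))"
      if "p \<in> space config_space" for p
      using that prof_A[of "fst (fst p)" "snd (fst p)" "snd (snd p)"]
      by (simp add: stage_R_Suc R_upd_eq_fill u_def space_pair_measure space_lf_measures mem_Times_iff)
    show ?thesis by (subst measurable_cong[OF eq]) measurable
  qed
  then show ?case using A_meas A_bounds R_bounds by blast
qed

lemmas stage_A_measurable = stage_invariants[THEN conjunct1]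
  and stage_R_measurable = stage_invariants[THEN conjunct2, THEN conjunct1]

subsection \<open>The limit density and its stability\<close>

text \<open>Fatou's lemma. Stage densities are differences of increasing sequences and need not be
  monotone, and mass may be lost in the limit.\<close>

lemma nn_integral_limit_le_one:
  fixes f :: "nat \<Rightarrow> 'a \<Rightarrow> real"
  assumes [measurable]: "\<And>n. f n \<in> borel_measurable M"
    and lim: "\<And>y. (\<lambda>n. f n y) \<longlonglongrightarrow> g y" and le: "\<And>n. (\<integral>\<^sup>+ y. ennreal (f n y) \<partial>M) \<le> 1"
  shows "(\<integral>\<^sup>+ y. ennreal (g y) \<partial>M) \<le> 1"
proof -
  have "ennreal (g y) = liminf (\<lambda>n. ennreal (f n y))" for y
    using lim_imp_Liminf[OF _ tendsto_ennrealI[OF lim[of y]]] by simp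
  then have "(\<integral>\<^sup>+ y. ennreal (g y) \<partial>M) \<le> liminf (\<lambda>n. \<integral>\<^sup>+ y. ennreal (f n y) \<partial>M)"
    using nn_integral_liminf[of "\<lambda>n y. ennreal (f n y)" M] by simp
  also have "\<dots> \<le> liminf (\<lambda>n. 1)" using le by (intro Liminf_mono) simp
  finally show ?thesis by (simp add: Liminf_const)
qed

text \<open>A common bounded support keeps mass from escaping: the indicator of
  \<open>cball x a\<close> dominates and is integrable by local finiteness.\<close>

lemma nn_integral_limit_eq_one:
  fixes f :: "nat \<Rightarrow> 'a::euclidean_space \<Rightarrow> real"
  assumes lf: "locally_finite_borel M"
    and meas: "\<And>n. f n \<in> borel_measurable borel"
    and lim: "\<And>y. (\<lambda>n. f n y) \<longlonglongrightarrow> g y" and one: "\<And>n. (\<integral>\<^sup>+ y. ennreal (f n y) \<partial>M) = 1"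
    and le: "\<And>n y. f n y \<le> 1" and out: "\<And>n y. a < dist x y \<Longrightarrow> f n y = 0"
  shows "(\<integral>\<^sup>+ y. ennreal (g y) \<partial>M) = 1"
proof -
  have [measurable_cong]: "sets M = sets borel" using lf by (rule sets_locally_finite_borel)
  note [measurable] = meas borel_measurable_LIMSEQ_real[OF lim meas]
  have [measurable]: "cball x a \<in> sets borel" by simp
  have "(\<lambda>n. \<integral>\<^sup>+ y. ennreal (f n y) \<partial>M) \<longlonglongrightarrow> (\<integral>\<^sup>+ y. ennreal (g y) \<partial>M)"
  proof (rule nn_integral_dominated_convergence[where w = "indicator (cball x a)"])
    show "AE y in M. ennreal (f n y) \<le> indicator (cball x a) y" for n
      using le[of n] out[of _ n] by (auto simp: indicator_def not_le)
    show "(\<integral>\<^sup>+ y. indicator (cball x a) y \<partial>M) < \<infinity>"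
      using lf by (subst nn_integral_indicator) (auto simp: locally_finite_borel_def)
    show "AE y in M. (\<lambda>n. ennreal (f n y)) \<longlonglongrightarrow> ennreal (g y)"
      using lim by (auto intro: tendsto_ennrealI)
  qed measurable
  then show ?thesis by (simp add: one LIMSEQ_const_iff)
qed

section \<open>Stages and limits for a fixed pair of measures\<close>

locale measure_pair =
  fixes \<phi> \<psi> :: "'a::euclidean_space measure"
  assumes lf_sites: "locally_finite_borel \<phi>" and lf_centers: "locally_finite_borel \<psi>"
begin

abbreviation "A \<equiv> stage_A \<phi> \<psi>"
abbreviation "R \<equiv> stage_R \<phi> \<psi>"
abbreviation "f\<^sub>s \<equiv> site_optimal \<phi> \<psi>"

lemma sets_sites [measurable_cong]: "sets \<phi> = sets borel"
  and sets_centers [measurable_cong]: "sets \<psi> = sets borel"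
  using lf_sites lf_centers by (simp_all add: sets_locally_finite_borel)

lemma R_nonneg: "0 \<le> R n x \<xi>" and R_le_A: "R n x \<xi> \<le> A n x \<xi>" and A_le_one: "A n x \<xi> \<le> 1"
  using stage_invariants[of n] lf_sites lf_centers by blast+

lemma A_nonneg: "0 \<le> A n x \<xi>"
  using R_nonneg R_le_A by (rule order_trans)

lemma R_le_one: "R n x \<xi> \<le> 1"
  using R_le_A A_le_one by (rule order_trans)

lemma A_site_measurable [measurable]: "(\<lambda>x. A n x \<xi>) \<in> borel_measurable borel"
  and A_center_measurable [measurable]: "(\<lambda>\<xi>. A n x \<xi>) \<in> borel_measurable borel"
  by (rule config_section_site[where F = "\<lambda>\<phi> \<psi>. stage_A \<phi> \<psi> n"]
      config_section_center[where F = "\<lambda>\<phi> \<psi>. stage_A \<phi> \<psi> n"];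
      rule stage_A_measurable lf_sites lf_centers)+

lemma R_site_measurable [measurable]: "(\<lambda>x. R n x \<xi>) \<in> borel_measurable borel"
  and R_center_measurable [measurable]: "(\<lambda>\<xi>. R n x \<xi>) \<in> borel_measurable borel"
  by (rule config_section_site[where F = "\<lambda>\<phi> \<psi>. stage_R \<phi> \<psi> n"]
      config_section_center[where F = "\<lambda>\<phi> \<psi>. stage_R \<phi> \<psi> n"];
      rule stage_R_measurable lf_sites lf_centers)+

lemma mass_profile_A: "mass_profile \<phi> (\<lambda>x. A n x \<xi>)"
  using lf_sites A_nonneg A_le_one by unfold_locales auto

lemma mass_profile_R: "mass_profile \<psi> (\<lambda>\<xi>. 1 - R n x \<xi>)"
  using lf_centers R_nonneg R_le_one by unfold_locales auto

text \<open>Growth of \<open>R\<close> gives growth of \<open>A\<close>, which gives the next growth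
  of \<open>R\<close>. The chain starts at stage 0, where both vanish.\<close>

lemma stage_Suc_mono: "A n x \<xi> \<le> A (Suc n) x \<xi> \<and> R n x \<xi> \<le> R (Suc n) x \<xi>"
proof (induction n arbitrary: x \<xi>)
  case 0
  show ?case using A_nonneg[of "Suc 0"] R_nonneg[of "Suc 0"] by simp
next
  case (Suc n)
  have A: "A (Suc n) x \<xi> \<le> A (Suc (Suc n)) x \<xi>" for x \<xi>
    unfolding stage_A_Suc[of _ _ n] stage_A_Suc[of _ _ "Suc n"]
    by (rule A_upd_mono[OF mass_profile_R mass_profile_R]) (use Suc in blast)
  have "R (Suc n) x \<xi> \<le> R (Suc (Suc n)) x \<xi>"
    unfolding stage_R_Suc[of _ _ n] stage_R_Suc[of _ _ "Suc n"]
    by (rule R_upd_mono[OF mass_profile_A mass_profile_A]) (rule A)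
  with A show ?case by blast
qed

lemma incseq_A: "incseq (\<lambda>n. A n x \<xi>)" and incseq_R: "incseq (\<lambda>n. R n x \<xi>)"
  using stage_Suc_mono by (auto intro: incseq_SucI)

definition "A\<^sub>s x \<xi> = lim (\<lambda>n. A n x \<xi>)"
definition "R\<^sub>s x \<xi> = lim (\<lambda>n. R n x \<xi>)"

lemma A_LIMSEQ: "(\<lambda>n. A n x \<xi>) \<longlonglongrightarrow> A\<^sub>s x \<xi>"
  unfolding A\<^sub>s_def convergent_LIMSEQ_iff[symmetric]
  using incseq_convergent[OF incseq_A, of x \<xi> 1] A_le_one unfolding convergent_def by metis

lemma R_LIMSEQ: "(\<lambda>n. R n x \<xi>) \<longlonglongrightarrow> R\<^sub>s x \<xi>"
  unfolding R\<^sub>s_def convergent_LIMSEQ_iff[symmetric]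
  using incseq_convergent[OF incseq_R, of x \<xi> 1] R_le_one unfolding convergent_def by metis

lemma f_eq: "f\<^sub>s x \<xi> = A\<^sub>s x \<xi> - R\<^sub>s x \<xi>"
  by (simp add: site_optimal_def A\<^sub>s_def R\<^sub>s_def)

text \<open>Two approximations of one limit: \<open>A n - R n\<close> is what centers retain and
  controls integrals over sites, while \<open>A (Suc n) - R n\<close> is what sites have pending and
  controls integrals over centers.\<close>

lemma f_LIMSEQ: "(\<lambda>n. A n x \<xi> - R n x \<xi>) \<longlonglongrightarrow> f\<^sub>s x \<xi>"
  and f_LIMSEQ_Suc: "(\<lambda>n. A (Suc n) x \<xi> - R n x \<xi>) \<longlonglongrightarrow> f\<^sub>s x \<xi>"
  unfolding f_eq by (intro tendsto_diff A_LIMSEQ R_LIMSEQ LIMSEQ_Suc)+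

lemma A\<^sub>s_le_one: "A\<^sub>s x \<xi> \<le> 1" and R\<^sub>s_nonneg: "0 \<le> R\<^sub>s x \<xi>"
  using LIMSEQ_le_const2[OF A_LIMSEQ, of x \<xi> 1] LIMSEQ_le_const[OF R_LIMSEQ, of 0 x \<xi>]
    A_le_one R_nonneg by auto

lemma f_nonneg: "0 \<le> f\<^sub>s x \<xi>"
  using LIMSEQ_le_const[OF f_LIMSEQ, of 0 x \<xi>] R_le_A by auto

lemma f_le_one: "f\<^sub>s x \<xi> \<le> 1"
  using A\<^sub>s_le_one[of x \<xi>] R\<^sub>s_nonneg[of x \<xi>] by (simp add: f_eq)

text \<open>Index shift: \<open>site_radius n\<close> and \<open>center_radius n\<close> are both
  the radii used in stage \<open>Suc n\<close>.\<close>

definition site_radius :: "nat \<Rightarrow> 'a \<Rightarrow> ereal" where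
  "site_radius n x = fill_radius \<psi> (\<lambda>\<xi>. 1 - R n x \<xi>) x"

definition center_radius :: "nat \<Rightarrow> 'a \<Rightarrow> ereal" where
  "center_radius n \<xi> = fill_radius \<phi> (\<lambda>x. A (Suc n) x \<xi>) \<xi>"

lemma center_radius_decseq: "decseq (\<lambda>n. center_radius n \<xi>)"
  unfolding center_radius_def using stage_Suc_mono by (intro decseq_SucI fill_radius_antimono) blast

lemma A_Suc_eq_1: "ereal (dist x \<xi>) < site_radius n x \<Longrightarrow> A (Suc n) x \<xi> = 1"
  by (simp add: stage_A_Suc A_upd_eq_fill[where R = "R n", OF mass_profile_R] site_radius_def fill_def)

lemma A_Suc_eq_0: "site_radius n x < ereal (dist x \<xi>) \<Longrightarrow> A (Suc n) x \<xi> = 0"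
  by (simp add: stage_A_Suc A_upd_eq_fill[where R = "R n", OF mass_profile_R] site_radius_def)

text \<open>Beyond the radius monotonicity gives \<open>R n \<le> A n \<le> A (Suc n) = 0\<close>,
  so the cutoff of \<open>A_upd_eq_fill\<close> removes nothing.\<close>

lemma application_eq_fill: "A (Suc n) x \<xi> - R n x \<xi> = fill 0 \<psi> (\<lambda>\<xi>. 1 - R n x \<xi>) x \<xi>"
proof (cases "ereal (dist x \<xi>) \<le> site_radius n x")
  case True
  then show ?thesis
    by (simp add: stage_A_Suc A_upd_eq_fill[where R = "R n", OF mass_profile_R] site_radius_def)
next
  case False
  then have "A (Suc n) x \<xi> = 0" by (intro A_Suc_eq_0) simp
  moreover from this have "R n x \<xi> = 0"
    using stage_Suc_mono[of n x \<xi>] R_le_A[of n x \<xi>] R_nonneg[of n x \<xi>] by simp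
  ultimately show ?thesis using False by (auto simp: fill_def site_radius_def)
qed

lemma acceptance_eq_fill: "A (Suc n) x \<xi> - R (Suc n) x \<xi> = fill 1 \<phi> (\<lambda>x. A (Suc n) x \<xi>) \<xi> x"
  by (simp add: stage_R_Suc R_upd_eq_fill[where A = "A (Suc n)", OF mass_profile_A])

lemma R_Suc_eq_0: "ereal (dist x \<xi>) < center_radius n \<xi> \<Longrightarrow> R (Suc n) x \<xi> = 0"
  using acceptance_eq_fill[of n x \<xi>] by (simp add: fill_def center_radius_def dist_commute)

lemma R_Suc_eq_A: "center_radius n \<xi> < ereal (dist x \<xi>) \<Longrightarrow> R (Suc n) x \<xi> = A (Suc n) x \<xi>"
  using acceptance_eq_fill[of n x \<xi>] by (auto simp: fill_def center_radius_def dist_commute split: if_splits)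

section \<open>Sub-balancing, exhausted sites and sated centers\<close>

lemma sub_balancing_f: "sub_balancing \<phi> \<psi> f\<^sub>s"
  unfolding sub_balancing_def
proof (intro conjI allI)
  fix x
  show "(\<integral>\<^sup>+ \<xi>. ennreal (f\<^sub>s x \<xi>) \<partial>\<psi>) \<le> 1"
  proof (rule nn_integral_limit_le_one[OF _ f_LIMSEQ_Suc])
    show "(\<integral>\<^sup>+ \<xi>. ennreal (A (Suc n) x \<xi> - R n x \<xi>) \<partial>\<psi>) \<le> 1" for n
      unfolding application_eq_fill
      by (rule mass_profile.nn_integral_fill_le_one[OF mass_profile_R]) simp_all
  qed measurable
next
  fix \<xi>
  show "(\<integral>\<^sup>+ x. ennreal (f\<^sub>s x \<xi>) \<partial>\<phi>) \<le> 1"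
  proof (rule nn_integral_limit_le_one[OF _ LIMSEQ_Suc[OF f_LIMSEQ]])
    show "(\<integral>\<^sup>+ x. ennreal (A (Suc n) x \<xi> - R (Suc n) x \<xi>) \<partial>\<phi>) \<le> 1" for n
      unfolding acceptance_eq_fill
      by (rule mass_profile.nn_integral_fill_le_one[OF mass_profile_A]) simp_all
  qed measurable
qed

text \<open>A finite radius makes the pending application integrate to exactly 1. Site radii can
  grow with \<open>n\<close>, so a bound uniform in \<open>n\<close> is what confines all
  applications to one ball.\<close>

lemma exhausted_if_site_radius_bounded:
  assumes a: "\<And>n. site_radius n x \<le> ereal a"
  shows "exhausted \<psi> f\<^sub>s x"
  unfolding exhausted_def
proof (rule nn_integral_limit_eq_one[OF lf_centers _ f_LIMSEQ_Suc])
  show "(\<integral>\<^sup>+ \<xi>. ennreal (A (Suc n) x \<xi> - R n x \<xi>) \<partial>\<psi>) = 1" for n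
    unfolding application_eq_fill using a[of n]
    by (intro mass_profile.nn_integral_fill_eq_one[OF mass_profile_R]) (auto simp: site_radius_def)
  show "A (Suc n) x \<xi> - R n x \<xi> \<le> 1" for n \<xi>
    using A_le_one[of "Suc n" x \<xi>] R_nonneg[of n x \<xi>] by linarith
  show "A (Suc n) x \<xi> - R n x \<xi> = 0" if "a < dist x \<xi>" for n \<xi>
  proof -
    have "site_radius n x < ereal (dist x \<xi>)" using a[of n] that by (simp add: le_less_trans)
    then show ?thesis by (auto simp: application_eq_fill fill_def site_radius_def)
  qed
qed measurable

text \<open>Center radii decrease, so finiteness at the single stage \<open>m\<close> bounds all
  later ones. The limit is taken along the stages from there on.\<close>

lemma sated_if_center_radius_finite:
  assumes "center_radius m \<xi> \<noteq> \<infinity>"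
  shows "sated \<phi> f\<^sub>s \<xi>"
proof -
  obtain a where a: "center_radius m \<xi> \<le> ereal a"
    using assms by (cases "center_radius m \<xi>") auto
  have le: "center_radius (n + m) \<xi> \<le> ereal a" for n
    using decseqD[OF center_radius_decseq, of m "n + m" \<xi>] a by (simp add: order_trans)
  show ?thesis
    unfolding sated_def
  proof (rule nn_integral_limit_eq_one[OF lf_sites])
    show "(\<lambda>n. A (Suc (n + m)) x \<xi> - R (Suc (n + m)) x \<xi>) \<longlonglongrightarrow> f\<^sub>s x \<xi>" for x
      using LIMSEQ_ignore_initial_segment[OF LIMSEQ_Suc[OF f_LIMSEQ]] .
    show "(\<integral>\<^sup>+ x. ennreal (A (Suc (n + m)) x \<xi> - R (Suc (n + m)) x \<xi>) \<partial>\<phi>) = 1" for n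
      unfolding acceptance_eq_fill using le[of n]
      by (intro mass_profile.nn_integral_fill_eq_one[OF mass_profile_A]) (auto simp: center_radius_def)
    show "A (Suc (n + m)) x \<xi> - R (Suc (n + m)) x \<xi> \<le> 1" for n x
      using A_le_one[of "Suc (n + m)" x \<xi>] R_nonneg[of "Suc (n + m)" x \<xi>] by linarith
    show "A (Suc (n + m)) x \<xi> - R (Suc (n + m)) x \<xi> = 0" if "a < dist \<xi> x" for n x
    proof -
      have "center_radius (n + m) \<xi> < ereal (dist x \<xi>)"
        using le[of n] that by (simp add: le_less_trans dist_commute)
      then show ?thesis by (simp add: R_Suc_eq_A)
    qed
  qed measurable
qed

section \<open>Stability\<close>

lemma A\<^sub>s_eq_one_if_site_desires:
  assumes "site_desires \<psi> f\<^sub>s x \<xi>"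
  shows "A\<^sub>s x \<xi> = 1"
proof -
  have "\<exists>n. ereal (dist x \<xi>) < site_radius n x"
  proof (cases "exhausted \<psi> f\<^sub>s x")
    case False
    \<comment> \<open>Otherwise all radii of the site would be at most \<open>dist x \<xi>\<close>,
      and bounded radii exhaust it.\<close>
    then show ?thesis using exhausted_if_site_radius_bounded[of x "dist x \<xi>"] by (meson not_le)
  next
    case True
    then obtain \<xi>1 where \<xi>1: "dist x \<xi> < dist x \<xi>1" "0 < f\<^sub>s x \<xi>1"
      using assms by (auto simp: site_desires_def)
    \<comment> \<open>Since \<open>R\<^sub>s\<close> is non-negative, positive density at
      \<open>\<xi>1\<close> requires an application there at some stage. The radius of that stage
      reaches \<open>\<xi>1\<close>, hence strictly exceeds the distance to
      \<open>\<xi>\<close>.\<close>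
    have "\<exists>n. A (Suc n) x \<xi>1 \<noteq> 0"
    proof (rule ccontr)
      assume "\<not> ?thesis"
      then have "(\<lambda>n. A (Suc n) x \<xi>1) \<longlonglongrightarrow> 0" by simp
      from LIMSEQ_unique[OF this LIMSEQ_Suc[OF A_LIMSEQ]] have "A\<^sub>s x \<xi>1 = 0" by simp
      then show False using \<xi>1(2) R\<^sub>s_nonneg[of x \<xi>1] by (simp add: f_eq)
    qed
    then obtain n where "A (Suc n) x \<xi>1 \<noteq> 0" by blast
    then have "ereal (dist x \<xi>1) \<le> site_radius n x" using A_Suc_eq_0 by (meson not_le)
    then have "ereal (dist x \<xi>) < site_radius n x"
      using \<xi>1(1) by (metis less_ereal.simps(1) less_le_trans)
    then show ?thesis by blast
  qed
  then obtain n where "A (Suc n) x \<xi> = 1" using A_Suc_eq_1 by blast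
  then show ?thesis
    using incseq_le[OF incseq_A A_LIMSEQ, of "Suc n" x \<xi>] A\<^sub>s_le_one[of x \<xi>] by simp
qed

lemma R\<^sub>s_eq_zero_if_center_desires:
  assumes "center_desires \<phi> f\<^sub>s \<xi> x"
  shows "R\<^sub>s x \<xi> = 0"
proof -
  have "ereal (dist x \<xi>) < center_radius n \<xi>" for n
  proof (cases "sated \<phi> f\<^sub>s \<xi>")
    case False
    then have "center_radius n \<xi> = \<infinity>" using sated_if_center_radius_finite by blast
    then show ?thesis by simp
  next
    case True
    then obtain x1 where x1: "dist x \<xi> < dist x1 \<xi>" "0 < f\<^sub>s x1 \<xi>"
      using assms by (auto simp: center_desires_def)
    show ?thesis
    proof (rule ccontr)
      assume "\<not> ?thesis"
      then have n: "center_radius n \<xi> < ereal (dist x1 \<xi>)" using x1(1) by (simp add: not_less le_less_trans)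
      \<comment> \<open>From this stage on \<open>x1\<close> stays outside the decreasing radii, so
        its applications are rejected in full and the density at \<open>x1\<close> tends to
        0.\<close>
      have "center_radius (m + n) \<xi> < ereal (dist x1 \<xi>)" for m
        using decseqD[OF center_radius_decseq, of n "m + n" \<xi>] n by simp
      then have "(\<lambda>m. A (Suc (m + n)) x1 \<xi> - R (Suc (m + n)) x1 \<xi>) \<longlonglongrightarrow> 0"
        by (simp add: R_Suc_eq_A)
      from LIMSEQ_unique[OF this LIMSEQ_ignore_initial_segment[OF LIMSEQ_Suc[OF f_LIMSEQ]]]
      show False using x1(2) by simp
    qed
  qed
  then have "(\<lambda>n. R (Suc n) x \<xi>) \<longlonglongrightarrow> 0" by (simp add: R_Suc_eq_0)
  from LIMSEQ_unique[OF this LIMSEQ_Suc[OF R_LIMSEQ]] show ?thesis by simp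
qed

lemma stable_f: "stable \<phi> \<psi> f\<^sub>s"
proof -
  have False if "site_desires \<psi> f\<^sub>s x \<xi>" "center_desires \<phi> f\<^sub>s \<xi> x" for x \<xi>
    using A\<^sub>s_eq_one_if_site_desires[OF that(1)] R\<^sub>s_eq_zero_if_center_desires[OF that(2)] that(1)
    by (simp add: f_eq site_desires_def)
  then show ?thesis by (auto simp: stable_def)
qed

end

text \<open>Convergence of the stages is known at locally finite measures, which is all of the
  space, so the pointwise limit inherits joint measurability.\<close>

lemma site_optimal_measurable:
  "on_config site_optimal \<in> borel_measurable (config_space :: (_ \<times> 'a \<times> 'a::euclidean_space) measure)"
proof (rule borel_measurable_LIMSEQ_real)
  show "on_config (\<lambda>\<phi> \<psi> x \<xi>. stage_A \<phi> \<psi> n x \<xi> - stage_R \<phi> \<psi> n x \<xi>)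
      \<in> borel_measurable (config_space :: (_ \<times> 'a \<times> 'a) measure)" for n
    using stage_invariants[where 'a = 'a, of n] by (intro borel_measurable_diff) blast+
  show "(\<lambda>n. on_config (\<lambda>\<phi> \<psi> x \<xi>. stage_A \<phi> \<psi> n x \<xi> - stage_R \<phi> \<psi> n x \<xi>) p) \<longlonglongrightarrow> on_config site_optimal p"
    if "p \<in> space config_space" for p :: "('a measure \<times> 'a measure) \<times> 'a \<times> 'a"
    using that by (intro measure_pair.f_LIMSEQ)
      (auto simp: space_pair_measure space_lf_measures measure_pair_def)
qed

subsection \<open>Translation covariance\<close>

lemma locally_finite_borel_translate:
  fixes \<mu> :: "'a::euclidean_space measure"
  assumes "locally_finite_borel \<mu>"
  shows "locally_finite_borel (distr \<mu> borel (\<lambda>y. y - z))"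
  unfolding locally_finite_borel_def
proof (intro conjI allI impI)
  note sets = sets_locally_finite_borel[OF assms] and space = space_locally_finite_borel[OF assms]
  have [measurable]: "(\<lambda>y. y - z) \<in> measurable \<mu> borel"
    by (simp add: measurable_cong_sets[OF sets refl])
  fix K :: "'a set" assume K: "compact K"
  have "(\<lambda>y. y - z) -` K = (+) z ` K" by (force simp: image_iff algebra_simps)
  then have "compact ((\<lambda>y. y - z) -` K)" using compact_translation[OF K] by simp
  then show "emeasure (distr \<mu> borel (\<lambda>y. y - z)) K < \<infinity>"
    using assms K by (simp add: emeasure_distr borel_compact space locally_finite_borel_def)
qed simp

lemma fill_translate:
  fixes \<mu> :: "'a::euclidean_space measure"
  assumes "locally_finite_borel \<mu>" and u: "u \<in> borel_measurable borel"
  shows fill_radius_translate: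
      "fill_radius (distr \<mu> borel (\<lambda>y. y - z)) (\<lambda>y. u (y + z)) x = fill_radius \<mu> u (x + z)"
    and "fill e (distr \<mu> borel (\<lambda>y. y - z)) (\<lambda>y. u (y + z)) x y = fill e \<mu> u (x + z) (y + z)"
proof -
  note sets = sets_locally_finite_borel[OF assms(1)]
  have T: "(\<lambda>y. y - z) \<in> measurable \<mu> borel"
    by (simp add: measurable_cong_sets[OF sets refl])
  have u': "(\<lambda>y. u (y + z)) \<in> borel_measurable borel"
    by (rule measurable_compose[OF _ u]) measurable
  have dist: "dist x (y - z) = dist (x + z) y" for y
    by (simp add: dist_norm algebra_simps)
  \<comment> \<open>The closed balls, the inner region and the rim are all given by a condition on
    the distance to the base point, so one change of variables covers every integral in
    \<open>fill\<close>.\<close>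
  have int: "(\<integral>\<^sup>+ y\<in>{y. P (dist x y)}. ennreal (u (y + z)) \<partial>distr \<mu> borel (\<lambda>y. y - z)) =
      (\<integral>\<^sup>+ y\<in>{y. P (dist (x + z) y)}. ennreal (u y) \<partial>\<mu>)" if P: "Measurable.pred borel P" for P
    using u' P by (subst nn_integral_distr[OF T]) (auto simp: dist indicator_def)
  show rad: "fill_radius (distr \<mu> borel (\<lambda>y. y - z)) (\<lambda>y. u (y + z)) x = fill_radius \<mu> u (x + z)"
    unfolding fill_radius_def cball_def by (subst int) simp_all
  have "inner_mass (distr \<mu> borel (\<lambda>y. y - z)) (\<lambda>y. u (y + z)) x = inner_mass \<mu> u (x + z)"
    "rim_mass (distr \<mu> borel (\<lambda>y. y - z)) (\<lambda>y. u (y + z)) x = rim_mass \<mu> u (x + z)"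
    unfolding inner_mass_def rim_mass_def rad by (subst int; simp)+
  moreover have "dist x y = dist (x + z) (y + z)" by (simp add: dist_norm)
  ultimately show "fill e (distr \<mu> borel (\<lambda>y. y - z)) (\<lambda>y. u (y + z)) x y = fill e \<mu> u (x + z) (y + z)"
    by (simp add: fill_def rim_share_def rad)
qed

text \<open>The map \<open>y - z\<close> carries mass at \<open>x + z\<close> to \<open>x\<close>,
  whence the sign of the shift. Each update is an instance of the translation-invariant
  \<open>fill\<close>, so covariance passes from \<open>R\<close> to the next \<open>A\<close> and
  on to the next \<open>R\<close>.\<close>

lemma stages_translate:
  fixes \<phi> \<psi> :: "'a::euclidean_space measure" and z :: 'a
  assumes lf: "locally_finite_borel \<phi>" "locally_finite_borel \<psi>"
  defines "\<phi>' \<equiv> distr \<phi> borel (\<lambda>y. y - z)" and "\<psi>' \<equiv> distr \<psi> borel (\<lambda>y. y - z)"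
  shows "stage_A \<phi>' \<psi>' n x \<xi> = stage_A \<phi> \<psi> n (x + z) (\<xi> + z) \<and>
    stage_R \<phi>' \<psi>' n x \<xi> = stage_R \<phi> \<psi> n (x + z) (\<xi> + z)"
proof (induction n arbitrary: x \<xi>)
  case 0
  then show ?case by simp
next
  case (Suc n)
  interpret P: measure_pair \<phi> \<psi> using lf by unfold_locales
  interpret P': measure_pair \<phi>' \<psi>'
    using lf by (simp add: measure_pair_def \<phi>'_def \<psi>'_def locally_finite_borel_translate)
  have A: "stage_A \<phi>' \<psi>' (Suc n) x \<xi> = stage_A \<phi> \<psi> (Suc n) (x + z) (\<xi> + z)" for x \<xi>
  proof -
    have u: "(\<lambda>\<xi>. 1 - stage_R \<phi>' \<psi>' n x \<xi>) = (\<lambda>\<xi>. (\<lambda>\<eta>. 1 - stage_R \<phi> \<psi> n (x + z) \<eta>) (\<xi> + z))"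
      using Suc by simp
    have [measurable]: "(\<lambda>\<eta>. 1 - stage_R \<phi> \<psi> n (x + z) \<eta>) \<in> borel_measurable borel" by measurable
    have "fill_radius \<psi>' (\<lambda>\<xi>. 1 - stage_R \<phi>' \<psi>' n x \<xi>) x =
          fill_radius \<psi> (\<lambda>\<eta>. 1 - stage_R \<phi> \<psi> n (x + z) \<eta>) (x + z)"
      "fill 0 \<psi>' (\<lambda>\<xi>. 1 - stage_R \<phi>' \<psi>' n x \<xi>) x \<xi> =
          fill 0 \<psi> (\<lambda>\<eta>. 1 - stage_R \<phi> \<psi> n (x + z) \<eta>) (x + z) (\<xi> + z)"
      unfolding u unfolding \<psi>'_def by (rule fill_translate[OF lf(2)]; measurable)+
    moreover have "dist x \<xi> = dist (x + z) (\<xi> + z)" by (simp add: dist_norm)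
    ultimately show ?thesis
      using Suc[of x \<xi>]
      by (simp add: stage_A_Suc A_upd_eq_fill[where R = "stage_R \<phi> \<psi> n", OF P.mass_profile_R]
          A_upd_eq_fill[where R = "stage_R \<phi>' \<psi>' n", OF P'.mass_profile_R])
  qed
  have "fill 1 \<phi>' (\<lambda>x. stage_A \<phi>' \<psi>' (Suc n) x \<xi>) \<xi> x =
        fill 1 \<phi> (\<lambda>x. stage_A \<phi> \<psi> (Suc n) x (\<xi> + z)) (\<xi> + z) (x + z)"
    unfolding A unfolding \<phi>'_def by (rule fill_translate(2)[OF lf(1)]) measurable
  then have "stage_R \<phi>' \<psi>' (Suc n) x \<xi> = stage_R \<phi> \<psi> (Suc n) (x + z) (\<xi> + z)"
    using A[of x \<xi>]
    by (simp add: stage_R_Suc R_upd_eq_fill[where A = "stage_A \<phi> \<psi> (Suc n)", OF P.mass_profile_A]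
        R_upd_eq_fill[where A = "stage_A \<phi>' \<psi>' (Suc n)", OF P'.mass_profile_A])
  with A show ?case by blast
qed

theorem mainTheorem4:
  fixes \<phi> \<psi> :: "'a::euclidean_space measure"
  assumes "locally_finite_borel \<phi>" and "locally_finite_borel \<psi>"
  shows "constrained \<phi> \<psi> (site_optimal \<phi> \<psi>) \<and> stable \<phi> \<psi> (site_optimal \<phi> \<psi>)
    \<and> (\<lambda>((\<phi>', \<psi>'), (x, \<xi>)). site_optimal \<phi>' \<psi>' x \<xi>)
         \<in> borel_measurable ((lf_measures \<Otimes>\<^sub>M lf_measures) \<Otimes>\<^sub>M (borel \<Otimes>\<^sub>M (borel :: 'a measure)))
    \<and> (\<forall>z x \<xi>. site_optimal (distr \<phi> borel (\<lambda>y. y - z)) (distr \<psi> borel (\<lambda>y. y - z)) x \<xi>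
                = site_optimal \<phi> \<psi> (x + z) (\<xi> + z))"
proof (intro conjI allI)
  interpret measure_pair \<phi> \<psi> using assms by unfold_locales
  show "constrained \<phi> \<psi> (site_optimal \<phi> \<psi>)"
    \<comment> \<open>Measurability of the density for fixed measures is a section of the joint
      measurability.\<close>
    using config_section[OF site_optimal_measurable assms] f_nonneg f_le_one sub_balancing_f
    by (simp add: constrained_def density_def)
  show "stable \<phi> \<psi> (site_optimal \<phi> \<psi>)" by (rule stable_f)
  show "(\<lambda>((\<phi>', \<psi>'), (x, \<xi>)). site_optimal \<phi>' \<psi>' x \<xi>)
         \<in> borel_measurable ((lf_measures \<Otimes>\<^sub>M lf_measures) \<Otimes>\<^sub>M (borel \<Otimes>\<^sub>M (borel :: 'a measure)))"
    using site_optimal_measurable by (simp add: case_prod_unfold)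
  show "site_optimal (distr \<phi> borel (\<lambda>y. y - z)) (distr \<psi> borel (\<lambda>y. y - z)) x \<xi>
      = site_optimal \<phi> \<psi> (x + z) (\<xi> + z)" for z x \<xi>
    using stages_translate[OF assms] by (simp add: site_optimal_def)
qed

end
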